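(* Let $z$ have density $\pi$ on $\mathbb R$, $\hat z\mid z\sim N(z,1)$, and let a finding be published ($D=1$) with probability $\Pr(D=1\mid\hat z)=s_{\theta_0}(\hat z)$, where $\{s_\theta\}_{\theta\in\Theta}$ is a known family of functions and $\theta_0\in\Theta$ is unknown. Let $|\hat z_1|,\dots,|\hat z_n|$ be observed, such that: (1) the $|\hat z_i|$ are identically distributed, with the distribution of $|\hat z|$ conditional on $D=1$; (2) each observation belongs to an article, and sets of $\hat z_i$ drawn from different articles are independent; (3) there is a universal constant $L\ge 1$ such that each article contributes no more than $L$ observations to the sample. Suppose that the density $\pi$ is bounded. Assume that each $s_\theta$ is even and $\inf_{\theta\in\Theta,\,t\in\mathbb R}s_\theta(t)>0$. Let $J_n=\left\lceil\frac{2}{3\log 2}\log(An)\right\rceil$ for any $A>0$. Assume further that an estimator $\widehat\theta_n$ (taking values in $\Theta$) satisfies $$\sup_{t\in\mathbb R}\, n^{1/3}\left|\frac{1}{s_{\widehat\theta_n}(t)}-\frac{1}{s_{\theta_0}(t)}\right|=\mathcal O_p(1).$$ Then, for every $p\in(0,1)$, as $n\to\infty$, $$\widehat r^{\,np}(p)\xrightarrow{\;p\;} r(p),$$ where $r(p)$ and the estimator $\widehat r^{\,np}(p)$ are as defined in the context.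
   Context: $\Phi,\varphi$ are the standard normal CDF and density; $cv(p)=\Phi^{-1}(1-p/2)$; $c=1.96$; $\widetilde\pi(z)=\frac{\pi(z)+\pi(-z)}{2}$. $\mathrm{He}_j$ is the $j$th probabilists' Hermite polynomial and $\psi_j(x)=\mathrm{He}_j(x)/\sqrt{j!}$. Target (predictive power): the probability that a replication $\hat z_r\mid z\sim N(z,1)$ (conditionally independent of $\hat z$ given $z$) satisfies $|\hat z_r|\ge 1.96$ and $\operatorname{sign}(\hat z_r)=\operatorname{sign}(\hat z)$, conditional on $|\hat z|=cv(p)$ and $D=1$, i.e. $$r(p)=\frac{\int_{\mathbb R}[1-\Phi(1.96-z)]\varphi(cv(p)-z)\widetilde\pi(z)\,dz}{\int_{\mathbb R}\varphi(cv(p)-z)\widetilde\pi(z)\,dz}.$$ Estimator: $$\widehat r^{\,np}(p)=1-\frac{\sum_{j=0}^{J_n}a_j\widehat b_j}{\sum_{j=0}^{J_n}d_j\widehat b_j},$$ $$\widehat b_j=\frac{2^{j/2}}{n}\sum_{i=1}^n\frac{\psi_j(cv(p)-|\hat z_i|)\varphi(cv(p)-|\hat z_i|)+\psi_j(cv(p)+|\hat z_i|)\varphi(cv(p)+|\hat z_i|)}{s_{\widehat\theta_n}(\hat z_i)},$$ $$a_j=\int_{\mathbb R}\varphi(u)e^{-u^2/2}\,\Phi\left(c-cv(p)+\sqrt2\,u\right)\psi_j(u)\,du,\qquad d_j=\int_{\mathbb R}\varphi(u)e^{-u^2/2}\psi_j(u)\,du.$$ Since $s_\theta$ is even, $s_{\widehat\theta_n}(\hat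 z_i)=s_{\widehat\theta_n}(|\hat z_i|)$. *)

theory Defs
  imports "HOL-Probability.Probability"
begin

definition std_normal_cdf :: "real \<Rightarrow> real" where
  "std_normal_cdf x = cdf std_normal_distribution x"

text \<open>The normal distribution function is a strictly increasing bijection from the reals onto
  the interval from 0 to 1 (ends excluded), so \<open>inv\<close> is its genuine inverse at \<open>1 - p / 2\<close> for
  every \<open>p\<close> strictly between 0 and 1.\<close>

definition cv :: "real \<Rightarrow> real" where
  "cv p = inv std_normal_cdf (1 - p / 2)"

definition symmetrized :: "(real \<Rightarrow> real) \<Rightarrow> real \<Rightarrow> real" where
  "symmetrized f z = (f z + f (- z)) / 2"

fun He :: "nat \<Rightarrow> real \<Rightarrow> real" where
  "He 0 x = 1"
| "He (Suc 0) x = x"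
| "He (Suc (Suc j)) x = x * He (Suc j) x - real (Suc j) * He j x"

definition hermite_psi :: "nat \<Rightarrow> real \<Rightarrow> real" where
  "hermite_psi j x = He j x / sqrt (fact j)"

definition predictive_power :: "(real \<Rightarrow> real) \<Rightarrow> real \<Rightarrow> real" where
  "predictive_power \<pi> p =
     (\<integral>z. (1 - std_normal_cdf (1.96 - z)) * std_normal_density (cv p - z) * symmetrized \<pi> z \<partial>lborel) /
     (\<integral>z. std_normal_density (cv p - z) * symmetrized \<pi> z \<partial>lborel)"

definition coeff_a :: "real \<Rightarrow> nat \<Rightarrow> real" where
  "coeff_a p j =
     (\<integral>u. std_normal_density u * exp (- u\<^sup>2 / 2) * std_normal_cdf (1.96 - cv p + sqrt 2 * u)
           * hermite_psi j u \<partial>lborel)"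

definition coeff_d :: "nat \<Rightarrow> real" where
  "coeff_d j = (\<integral>u. std_normal_density u * exp (- u\<^sup>2 / 2) * hermite_psi j u \<partial>lborel)"

text \<open>In the next two definitions \<open>g\<close> is the (estimated) publication probability function and
  \<open>x 1, \<dots>, x n\<close> is the sample. For even \<open>g\<close> both depend on the sample only through its
  absolute values.\<close>

definition coeff_b_hat :: "real \<Rightarrow> nat \<Rightarrow> (real \<Rightarrow> real) \<Rightarrow> (nat \<Rightarrow> real) \<Rightarrow> nat \<Rightarrow> real" where
  "coeff_b_hat p n g x j =
     2 powr (real j / 2) / real n *
     (\<Sum>i = 1..n.
        (hermite_psi j (cv p - \<bar>x i\<bar>) * std_normal_density (cv p - \<bar>x i\<bar>)
         + hermite_psi j (cv p + \<bar>x i\<bar>) * std_normal_density (cv p + \<bar>x i\<bar>)) / g (x i))"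

text \<open>Converting to \<open>nat\<close> replaces a negative truncation point by 0. This can happen only for
  the finitely many \<open>n\<close> with \<open>A * n < 1\<close>.\<close>

definition trunc_J :: "real \<Rightarrow> nat \<Rightarrow> nat" where
  "trunc_J A n = nat \<lceil>2 / (3 * ln 2) * ln (A * real n)\<rceil>"

definition r_np :: "real \<Rightarrow> real \<Rightarrow> nat \<Rightarrow> (real \<Rightarrow> real) \<Rightarrow> (nat \<Rightarrow> real) \<Rightarrow> real" where
  "r_np A p n g x =
     1 - (\<Sum>j = 0..trunc_J A n. coeff_a p j * coeff_b_hat p n g x j) /
         (\<Sum>j = 0..trunc_J A n. coeff_d j * coeff_b_hat p n g x j)"

definition is_density :: "(real \<Rightarrow> real) \<Rightarrow> bool" where
  "is_density \<pi> \<longleftrightarrow> \<pi> \<in> borel_measurable borel \<and> (\<forall>z. 0 \<le> \<pi> z) \<and> (\<integral>\<^sup>+z. ennreal (\<pi> z) \<partial>lborel) = 1"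

text \<open>Joint law of the effect, its estimate and the publication indicator, in this order: the
  effect has density \<open>\<pi>\<close>, given the effect \<open>z\<close> the estimate is normal with mean \<open>z\<close> and variance
  1, and given the estimate \<open>x\<close> the indicator is true with probability \<open>g x\<close>.\<close>

definition finding_model :: "(real \<Rightarrow> real) \<Rightarrow> (real \<Rightarrow> real) \<Rightarrow> (real \<times> real \<times> bool) measure" where
  "finding_model \<pi> g =
     density (lborel \<Otimes>\<^sub>M lborel \<Otimes>\<^sub>M count_space UNIV)
       (\<lambda>(z, x, d). ennreal (\<pi> z * normal_density z 1 x * (if d then g x else 1 - g x)))"

definition published_abs_law :: "(real \<Rightarrow> real) \<Rightarrow> (real \<Rightarrow> real) \<Rightarrow> real measure" where
  "published_abs_law \<pi> g =
     distr (uniform_measure (finding_model \<pi> g) {(z, x, d). d}) borel (\<lambda>(z, x, d). \<bar>x\<bar>)"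

definition article_obs :: "nat \<Rightarrow> (nat \<Rightarrow> 'art) \<Rightarrow> 'art \<Rightarrow> nat set" where
  "article_obs n art a = {i \<in> {1..n}. art i = a}"

definition indep_across_articles ::
    "'w measure \<Rightarrow> nat \<Rightarrow> (nat \<Rightarrow> 'art) \<Rightarrow> (nat \<Rightarrow> 'w \<Rightarrow> real) \<Rightarrow> bool" where
  "indep_across_articles M n art Z \<longleftrightarrow>
     prob_space.indep_vars M (\<lambda>a. \<Pi>\<^sub>M i \<in> article_obs n art a. borel)
       (\<lambda>a \<omega>. \<lambda>i \<in> article_obs n art a. Z i \<omega>) (art ` {1..n})"

text \<open>Both stochastic order notions use outer probability, so that no measurability of the
  estimator of \<open>\<theta>\<close>, of suprema over the reals, or of quantities built from them is needed. For
  measurable events the outer probability is the probability. The spaces may vary with \<open>n\<close>.\<close>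

definition bounded_in_prob :: "(nat \<Rightarrow> 'w measure) \<Rightarrow> (nat \<Rightarrow> 'w \<Rightarrow> real) \<Rightarrow> bool" where
  "bounded_in_prob M X \<longleftrightarrow>
     (\<forall>\<epsilon>>0. \<exists>K. \<forall>\<^sub>F n in sequentially.
        outer_measure_of (M n) {\<omega> \<in> space (M n). K < \<bar>X n \<omega>\<bar>} \<le> ennreal \<epsilon>)"

definition converges_in_prob :: "(nat \<Rightarrow> 'w measure) \<Rightarrow> (nat \<Rightarrow> 'w \<Rightarrow> real) \<Rightarrow> real \<Rightarrow> bool" where
  "converges_in_prob M X c \<longleftrightarrow>
     (\<forall>\<epsilon>>0. (\<lambda>n. outer_measure_of (M n) {\<omega> \<in> space (M n). \<epsilon> < \<bar>X n \<omega> - c\<bar>}) \<longlonglongrightarrow> 0)"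

lemma converges_in_prob_measurable_iff:
  assumes "\<And>n. prob_space (M n)" and X: "\<And>n. X n \<in> borel_measurable (M n)"
  shows "converges_in_prob M X c \<longleftrightarrow>
    (\<forall>\<epsilon>>0. (\<lambda>n. measure (M n) {\<omega> \<in> space (M n). \<epsilon> < \<bar>X n \<omega> - c\<bar>}) \<longlonglongrightarrow> 0)"
proof -
  have "outer_measure_of (M n) {\<omega> \<in> space (M n). \<epsilon> < \<bar>X n \<omega> - c\<bar>}
      = ennreal (measure (M n) {\<omega> \<in> space (M n). \<epsilon> < \<bar>X n \<omega> - c\<bar>})" for n \<epsilon>
  proof -
    interpret prob_space "M n" by fact
    have [measurable]: "X n \<in> borel_measurable (M n)" by (rule X)
    have "{\<omega> \<in> space (M n). \<epsilon> < \<bar>X n \<omega> - c\<bar>} \<in> sets (M n)" by measurable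
    then show ?thesis by (simp add: emeasure_eq_measure)
  qed
  then show ?thesis
    unfolding converges_in_prob_def by (simp add: tendsto_ennreal_iff flip: ennreal_0)
qed

end

theory Submission
  imports Defs "HOL-Computational_Algebra.Polynomial"
begin

text \<open>
  In the variable \<open>u = (cv p - z) / sqrt 2\<close> numerator and denominator of \<open>r p\<close> are inner products, in
  \<open>L\<^sup>2\<close> of the standard normal law, of a bounded continuous function \<open>h\<close> with
  \<open>g u = symmetrized \<pi> (cv p - sqrt 2 * u)\<close>. Convolution with the normal density maps \<open>\<psi>\<^sub>j \<phi>\<close> to
  \<open>2 powr (- j / 2)\<close> times a rescaled copy of itself, and dividing by the publication probability undoes
  the selection, so the oracle version of \<open>coeff_b_hat\<close> is, up to a common factor, an unbiased estimator
  of the \<open>j\<close>th Hermite coefficient of \<open>g\<close>. The bias vanishes by completeness of the Hermite polynomials.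
  Since \<open>\<pi>\<close> is bounded, the weighted kernels have uniformly bounded second moments, and the oracle series
  has standard deviation of order \<open>2 powr (J / 2) / sqrt n\<close>, that is \<open>n powr (- 1 / 6)\<close>. The plug-in error
  is of order \<open>n powr (- 1 / 3)\<close> times the sum of \<open>\<bar>a\<^sub>j\<bar> * 2 powr (j / 2)\<close> over \<open>j \<le> J\<close>. There
  \<open>2 powr (J / 2)\<close> is itself of order \<open>n powr (1 / 3)\<close>, and the product tends to 0 only because
  \<open>a\<^sub>j \<longlonglongrightarrow> 0\<close> by Bessel's inequality.
\<close>

section \<open>Hermite polynomials under the standard normal distribution\<close>

text \<open>The density \<open>\<pi>\<close> is only bounded and measurable, so no rate of decay is
  available for its Hermite coefficients. All regularity sits in the weight \<open>h\<close>:
  Parseval's identity needs only the expansion of \<open>h\<close> to converge in mean square.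
  Polynomials are unbounded on the line, so Weierstrass does not apply to \<open>h\<close> directly.
  Polynomials in \<open>sin (l * u)\<close> are bounded, and the factorially small Taylor remainder
  of the sine, measured against Gaussian moments, turns them into polynomials in \<open>u\<close>.
  The factor \<open>2 powr (j / 2)\<close> in the estimator is the price of undoing the convolution.
  The probability of publication is never estimated: it enters numerator and denominator through the
  same constant and cancels, provided that the denominator has a positive limit. The estimator of
  \<theta> may use the same sample and may be nonmeasurable, so its error is separated outcome by
  outcome into a factor bounded in outer probability and a measurable average that involves only the
  true selection function.\<close>

lemma prob_space_std_normal [simp]: "prob_space std_normal_distribution"
  using prob_space_normal_density[of 1 0] by simp

lemma integral_std_normal_distribution:
  fixes f :: "real \<Rightarrow> real"
  assumes [measurable]: "f \<in> borel_measurable borel"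
  shows "(\<integral>x. f x \<partial>std_normal_distribution) = (\<integral>x. std_normal_density x * f x \<partial>lborel)"
  by (subst integral_density) auto

lemma integrable_std_normal_distribution_iff:
  fixes f :: "real \<Rightarrow> real"
  assumes [measurable]: "f \<in> borel_measurable borel"
  shows "integrable std_normal_distribution f \<longleftrightarrow> integrable lborel (\<lambda>x. std_normal_density x * f x)"
  by (subst integrable_density) auto

lemma poly_borel_measurable [measurable]: "poly q \<in> borel_measurable (borel :: real measure)"
  by (intro borel_measurable_continuous_onI continuous_intros)

lemma std_normal_integrable_poly [simp]: "integrable std_normal_distribution (poly q)"
proof -
  have "poly q = (\<lambda>x. \<Sum>i\<le>degree q. coeff q i * x ^ i)" by (auto simp: poly_altdef)
  then show ?thesis by (auto intro!: Bochner_Integration.integrable_sum integrable_std_normal_distribution_moment)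
qed

definition gauss :: "real poly \<Rightarrow> real" where
  "gauss q = (\<integral>x. poly q x \<partial>std_normal_distribution)"

lemma gauss_add: "gauss (q + r) = gauss q + gauss r"
  by (simp add: gauss_def)

lemma gauss_diff: "gauss (q - r) = gauss q - gauss r"
  by (simp add: gauss_def)

lemma gauss_smult: "gauss (smult c q) = c * gauss q"
  by (simp add: gauss_def)

lemma gauss_0 [simp]: "gauss 0 = 0"
  by (simp add: gauss_def)

lemma gauss_1 [simp]: "gauss 1 = 1"
  using prob_space.prob_space[OF prob_space_std_normal] by (simp add: gauss_def)

lemma gauss_monom_even: "gauss (monom 1 (2 * k)) = fact (2 * k) / (2 ^ k * fact k)"
  by (simp add: gauss_def poly_monom std_normal_distribution_even_moments)

lemma gauss_monom_odd: "gauss (monom 1 (Suc (2 * k))) = 0"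
  by (simp add: gauss_def poly_monom del: power_Suc) (simp add: integral_std_normal_distribution_moment_odd del: power_Suc)

text \<open>The moments obey the recursion that integration by parts would give; here it is read off
  the closed formulas for even and odd moments. It feeds both Stein's identity and the ratio test in
  the completeness argument.\<close>

lemma gauss_monom_Suc_Suc: "gauss (monom 1 (Suc (Suc k))) = real (Suc k) * gauss (monom 1 k)"
proof (cases "even k")
  case True
  then obtain m where k: "k = 2 * m" by auto
  have "gauss (monom 1 (2 * Suc m)) = real (Suc (2*m)) * gauss (monom 1 (2 * m))"
  proof -
    have "fact (2 * Suc m) = (2 * real m + 2) * ((2 * real m + 1) * fact (2 * m))"
      by (simp add: algebra_simps)
    moreover have "2 ^ Suc m * fact (Suc m) = (2 * real m + 2) * (2 ^ m * fact m)"
      by (simp add: algebra_simps)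
    ultimately have "gauss (monom 1 (2 * Suc m))
        = ((2 * real m + 2) * ((2 * real m + 1) * fact (2 * m))) / ((2 * real m + 2) * (2 ^ m * fact m))"
      unfolding gauss_monom_even by (simp only:)
    also have "\<dots> = (2 * real m + 1) * fact (2 * m) / (2 ^ m * fact m)"
      by (rule mult_divide_mult_cancel_left) simp
    finally show ?thesis by (simp add: gauss_monom_even)
  qed
  then show ?thesis by (simp add: k)
next
  case False
  then obtain m where k: "k = Suc (2 * m)" by (auto elim: oddE)
  have "gauss (monom 1 (Suc (2 * Suc m))) = 0" "gauss (monom 1 (Suc (2 * m))) = 0"
    by (rule gauss_monom_odd)+
  then show ?thesis by (simp add: k)
qed

text \<open>An identity or a limit that is linear in the polynomial has to be checked on monomials
  only.\<close>

lemma poly_linear_induct [case_names monom add smult]: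
  fixes q :: "real poly"
  assumes "\<And>k. P (monom 1 k)" "\<And>q r. P q \<Longrightarrow> P r \<Longrightarrow> P (q + r)" "\<And>c q. P q \<Longrightarrow> P (smult c q)"
  shows "P q"
proof -
  have 0: "P 0" using assms(3)[OF assms(1)[of 0], of 0] by (simp del: monom_0)
  have "P (\<Sum>i\<in>I. monom (coeff q i) i)" if "finite I" for I
    using that
  proof induction
    case (insert i I)
    have "P (smult (coeff q i) (monom 1 i))" by (intro assms)
    then show ?case using insert assms(2) by (simp add: smult_monom)
  qed (simp add: 0)
  from this[of "{..degree q}"] show ?thesis by (simp add: poly_as_sum_of_monoms)
qed

text \<open>Both sides are linear in \<open>q\<close>, which reduces the identity to the moment
  recursion. It stands in for integration by parts against the Gaussian density.\<close>

lemma gauss_stein: "gauss ([:0, 1:] * q) = gauss (pderiv q)"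
proof (induction q rule: poly_linear_induct)
  case (monom k)
  show ?case
  proof (cases k)
    case 0
    have "gauss (monom 1 (Suc (2 * 0))) = 0" by (rule gauss_monom_odd)
    then show ?thesis using 0 by (simp add: monom_altdef pderiv_1)
  next
    case (Suc j)
    have "[:0, 1:] * monom 1 k = (monom 1 (Suc (Suc j)) :: real poly)"
      by (simp add: Suc monom_altdef)
    moreover have "pderiv (monom 1 k) = smult (real (Suc j)) (monom 1 j)"
      by (simp add: Suc pderiv_monom smult_monom)
    ultimately show ?thesis by (simp add: gauss_monom_Suc_Suc gauss_smult)
  qed
next
  case (add q r)
  then show ?case by (simp add: distrib_left gauss_add pderiv_add del: mult_pCons_left)
next
  case (smult c q)
  then show ?case by (simp add: gauss_smult pderiv_smult del: mult_pCons_left)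
qed

text \<open>The recursion of \<open>He\<close> is repeated for polynomial objects, which gives
  access to \<open>pderiv\<close>, \<open>pcompose\<close> and \<open>degree\<close>.\<close>

fun hermite_poly :: "nat \<Rightarrow> real poly" where
  "hermite_poly 0 = 1"
| "hermite_poly (Suc 0) = [:0, 1:]"
| "hermite_poly (Suc (Suc j)) = [:0, 1:] * hermite_poly (Suc j) - smult (real (Suc j)) (hermite_poly j)"

lemma poly_hermite_poly: "poly (hermite_poly j) x = He j x"
  by (induction j x rule: He.induct) auto

lemma pderiv_hermite_poly: "pderiv (hermite_poly (Suc j)) = smult (real (Suc j)) (hermite_poly j)"
proof (induction j rule: hermite_poly.induct)
  case 1 show ?case by (simp add: pderiv_pCons)
next
  case 2 show ?case by (simp add: pderiv_pCons pderiv_mult pderiv_1)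
next
  case (3 j)
  have "pderiv (hermite_poly (Suc (Suc (Suc j)))) = hermite_poly (Suc (Suc j))
      + ([:0, 1:] * smult (real (Suc (Suc j))) (hermite_poly (Suc j))
         - smult (real (Suc (Suc j))) (smult (real (Suc j)) (hermite_poly j)))"
    using "3" by (simp add: pderiv_diff pderiv_mult pderiv_smult pderiv_pCons algebra_simps
      del: mult_pCons_left mult_pCons_right hermite_poly.simps(3)  add: hermite_poly.simps(3)[of "Suc j"])
  also have "\<dots> = hermite_poly (Suc (Suc j)) + smult (real (Suc (Suc j))) (hermite_poly (Suc (Suc j)))"
    by (simp add: smult_diff_right del: mult_pCons_left mult_pCons_right of_nat_Suc)
  also have "\<dots> = smult (real (Suc (Suc (Suc j)))) (hermite_poly (Suc (Suc j)))"
    by (metis of_nat_Suc smult_add_left smult_1_left)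
  finally show ?case .
qed

text \<open>Together with \<open>pderiv_hermite_poly\<close> the recursion reads: the next
  polynomial is x times the current one minus its derivative. By Stein's identity, multiplication by
  x minus differentiation is the adjoint of differentiation.\<close>

lemma gauss_hermite_poly_Suc: "gauss (hermite_poly (Suc j) * q) = gauss (hermite_poly j * pderiv q)"
proof (cases j)
  case 0
  then show ?thesis using gauss_stein[of q] by simp
next
  case (Suc i)
  have "gauss (hermite_poly (Suc j) * q)
      = gauss ([:0, 1:] * (hermite_poly j * q)) - gauss (pderiv (hermite_poly j) * q)"
    unfolding Suc by (simp only: pderiv_hermite_poly hermite_poly.simps left_diff_distrib gauss_diff mult.assoc)
  then show ?thesis
    by (simp only: gauss_stein pderiv_mult gauss_add) (simp add: mult.commute)
qed

text \<open>Each use of the adjoint relation lowers both indices by one and releases a factor; these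
  factors build up the factorial. If the indices differ, a constant is differentiated in the
  end.\<close>

lemma gauss_hermite_poly_orthogonal:
  "gauss (hermite_poly i * hermite_poly j) = (if i = j then fact j else 0)"
proof (induction i arbitrary: j)
  case 0
  show ?case
  proof (cases j)
    case (Suc k)
    have "gauss (hermite_poly (Suc k) * 1) = 0"
      unfolding gauss_hermite_poly_Suc by (simp add: pderiv_1)
    then show ?thesis by (simp add: Suc)
  qed simp
next
  case (Suc i)
  show ?case
  proof (cases j)
    case 0
    then show ?thesis by (simp only: gauss_hermite_poly_Suc) (simp add: pderiv_1)
  next
    case (Suc k)
    then show ?thesis
      by (simp only: gauss_hermite_poly_Suc pderiv_hermite_poly)
         (use Suc.IH in \<open>simp add: gauss_smult\<close>)
  qed
qed

lemma hermite_poly_monic: "degree (hermite_poly j) = j \<and> coeff (hermite_poly j) j = 1"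
proof (induction j rule: hermite_poly.induct)
  case (3 j)
  have d: "degree ([:0, 1:] * hermite_poly (Suc j)) = Suc (Suc j)"
    using 3 by (subst degree_mult_eq) auto
  have "degree (hermite_poly (Suc (Suc j))) = Suc (Suc j)"
    unfolding hermite_poly.simps
    by (subst diff_conv_add_uminus, subst degree_add_eq_left) (use 3 d in \<open>auto simp del: mult_pCons_left\<close>)
  moreover have "coeff (hermite_poly (Suc (Suc j))) (Suc (Suc j)) = 1"
    using 3 by (auto simp: coeff_eq_0)
  ultimately show ?case by blast
qed auto

definition hermite_psi_poly :: "nat \<Rightarrow> real poly" where
  "hermite_psi_poly j = smult (1 / sqrt (fact j)) (hermite_poly j)"

lemma poly_hermite_psi_poly: "poly (hermite_psi_poly j) x = hermite_psi j x"
  by (simp add: hermite_psi_poly_def hermite_psi_def poly_hermite_poly)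

lemma hermite_psi_eq_poly: "hermite_psi j = poly (hermite_psi_poly j)"
  by (simp add: fun_eq_iff poly_hermite_psi_poly)

lemma hermite_psi_measurable [measurable]: "hermite_psi j \<in> borel_measurable borel"
  by (simp add: hermite_psi_eq_poly)

lemma hermite_psi_orthonormal:
  "(\<integral>u. hermite_psi i u * hermite_psi j u \<partial>std_normal_distribution) = (if i = j then 1 else 0)"
proof -
  have "(\<integral>u. hermite_psi i u * hermite_psi j u \<partial>std_normal_distribution)
    = gauss (hermite_psi_poly i * hermite_psi_poly j)"
    by (simp add: gauss_def poly_hermite_psi_poly)
  then show ?thesis
    by (simp add: hermite_psi_poly_def gauss_smult gauss_hermite_poly_orthogonal)
qed

lemma hermite_psi_span:
  assumes "degree q \<le> n"
  shows "\<exists>c. poly q = (\<lambda>u. \<Sum>j\<le>n. c j * hermite_psi j u)"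
  using assms
proof (induction n arbitrary: q)
  case 0
  then obtain a where "q = [:a:]" by (auto dest: degree_eq_zeroE)
  then show ?case by (intro exI[of _ "\<lambda>_. a"]) (auto simp: hermite_psi_def)
next
  case (Suc n)
  \<comment> \<open>\<open>hermite_poly (Suc n)\<close> is monic, so the subtraction removes the
    leading term. The factor \<open>sqrt (fact (Suc n))\<close> in the new coefficient below
    converts \<open>He\<close> into \<open>hermite_psi\<close>.\<close>
  define r where "r = q - smult (coeff q (Suc n)) (hermite_poly (Suc n))"
  have "degree r \<le> n"
  proof (rule degree_le, intro allI impI)
    fix i assume "n < i"
    then show "coeff r i = 0"
      using Suc.prems hermite_poly_monic[of "Suc n"]
      by (cases "i = Suc n") (auto simp: r_def coeff_eq_0)
  qed
  then obtain c where c: "poly r = (\<lambda>u. \<Sum>j\<le>n. c j * hermite_psi j u)"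
    using Suc.IH by blast
  have "poly q u = (\<Sum>j\<le>Suc n. (c(Suc n := coeff q (Suc n) * sqrt (fact (Suc n)))) j * hermite_psi j u)" for u
  proof -
    have "poly q u = poly r u + coeff q (Suc n) * He (Suc n) u"
      by (simp add: r_def poly_hermite_poly)
    moreover have "(\<Sum>j\<le>n. (c(Suc n := coeff q (Suc n) * sqrt (fact (Suc n)))) j * hermite_psi j u)
        = (\<Sum>j\<le>n. c j * hermite_psi j u)"
      by (intro sum.cong) auto
    ultimately show ?thesis
      by (simp add: c hermite_psi_def del: He.simps fact_Suc)
  qed
  then show ?case by blast
qed

text \<open>The left-hand side is the Mehler operator with parameter \<open>1 / sqrt 2\<close>, applied to \<open>He j\<close> and
  evaluated at \<open>y / sqrt 2\<close>.\<close>

lemma gauss_hermite_mehler: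
  "gauss (pcompose (hermite_poly j) [:y / 2, 1 / sqrt 2:]) = 2 powr (- real j / 2) * He j (y / sqrt 2)"
proof (induction j rule: hermite_poly.induct)
  case 1
  show ?case by (simp add: pcompose_1)
next
  case 2
  have "[:y / 2, 1 / sqrt 2:] = smult (y / 2) 1 + smult (1 / sqrt 2) ([:0,1:] * 1)" by simp
  then have "gauss [:y / 2, 1 / sqrt 2:] = y / 2"
    by (simp only: gauss_add gauss_smult gauss_stein) (simp add: pderiv_1)
  moreover have "2 powr (- (1/2)) * (y / sqrt 2) = y / 2"
    by (simp add: powr_minus powr_half_sqrt field_simps)
  ultimately have "gauss [:y / 2, 1 / sqrt 2:] = 2 powr (- (1/2)) * (y / sqrt 2)" by (simp only:)
  then show ?case by (simp add: pcompose_pCons)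
next
  case (3 j)
  let ?m = "[:y / 2, 1 / sqrt 2:]"
  let ?P = "\<lambda>j. pcompose (hermite_poly j) ?m"
  have "?P (Suc (Suc j)) = smult (y / 2) (?P (Suc j)) + smult (1 / sqrt 2) ([:0,1:] * ?P (Suc j))
      - smult (real (Suc j)) (?P j)"
    by (simp add: pcompose_diff pcompose_mult pcompose_smult pcompose_pCons)
  \<comment> \<open>By Stein's identity the term with the factor x contributes
    \<open>real (Suc j) / 2\<close> times the value for \<open>j\<close>, which halves the
    subtracted term of the recursion. After the powers of 2 are balanced, this is the recursion of
    \<open>He\<close> at \<open>y / sqrt 2\<close>.\<close>
  moreover have "pderiv (?P (Suc j)) = smult (real (Suc j) / sqrt 2) (?P j)"
    by (simp add: pderiv_pcompose pderiv_hermite_poly pcompose_smult pderiv_pCons del: hermite_poly.simps of_nat_Suc)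
  ultimately have "gauss (?P (Suc (Suc j))) = y / 2 * gauss (?P (Suc j)) - real (Suc j) / 2 * gauss (?P j)"
    by (simp only: gauss_diff gauss_add gauss_smult gauss_stein) (simp add: field_simps)
  also have "\<dots> = 2 powr (- real (Suc (Suc j)) / 2) * He (Suc (Suc j)) (y / sqrt 2)"
  proof -
    have e1: "2 powr (- real (Suc j) / 2) = sqrt 2 * (2::real) powr (- real (Suc (Suc j)) / 2)"
    proof -
      have "- real (Suc j) / 2 = 1 / 2 + - real (Suc (Suc j)) / 2" by (simp add: field_simps)
      then show ?thesis by (simp only: powr_add powr_half_sqrt)
    qed
    have e2: "2 powr (- real j / 2) = 2 * (2::real) powr (- real (Suc (Suc j)) / 2)"
    proof -
      have "- real j / 2 = 1 + - real (Suc (Suc j)) / 2" by (simp add: field_simps)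
      then show ?thesis by (simp only: powr_add) simp
    qed
    show ?thesis unfolding 3 unfolding e1 e2 by (simp add: field_simps)
  qed
  finally show ?case .
qed

section \<open>Completeness of the Hermite polynomials\<close>

text \<open>The monomial is the square of \<open>(l * u) ^ N / fact N\<close>, the bound on the
  Taylor remainder of \<open>sin (l * u)\<close>. Gaussian moments of order \<open>2 * N\<close>
  grow roughly like a single factorial of \<open>N\<close>, so the squared factorial wins for every
  \<open>l\<close>, even against a further fixed polynomial \<open>r\<close>.\<close>

lemma gauss_monom_power_tendsto_0:
  "(\<lambda>N. gauss (monom (l ^ (2 * N) / (fact N)\<^sup>2) (2 * N) * r)) \<longlonglongrightarrow> 0"
proof (induction r rule: poly_linear_induct)
  case (monom k)
  define x where "x N = l ^ (2 * N) / (fact N)\<^sup>2 * gauss (monom 1 (2 * N + k))" for N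
  have eq: "gauss (monom (l ^ (2 * N) / (fact N)\<^sup>2) (2 * N) * monom 1 k) = x N" for N
    using gauss_smult[of "l ^ (2 * N) / (fact N)\<^sup>2" "monom 1 (2 * N + k)"]
    by (simp add: x_def mult_monom smult_monom)
  have rec: "x (Suc N) = l\<^sup>2 * real (2 * N + k + 1) / (real (Suc N))\<^sup>2 * x N" for N
  proof -
    have "gauss (monom 1 (2 * Suc N + k)) = real (2 * N + k + 1) * gauss (monom 1 (2 * N + k))"
      using gauss_monom_Suc_Suc[of "2 * N + k"] by simp
    moreover have "(fact (Suc N) :: real) = real (Suc N) * fact N" by simp
    ultimately show ?thesis
      unfolding x_def by (simp only:) (simp add: power2_eq_square power_add mult_ac)
  qed
  \<comment> \<open>Since \<open>2 * N + k + 1\<close> is at most \<open>(k + 2) * (N + 1)\<close>,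
    the ratio of consecutive terms is at most \<open>l\<^sup>2 * (k + 2) / (N + 1)\<close>, which
    the threshold brings down to one half.\<close>
  have "summable x"
  proof (rule summable_ratio_test[of "1 / 2" "nat \<lceil>2 * l\<^sup>2 * real (k + 2)\<rceil>"])
    fix N assume N: "nat \<lceil>2 * l\<^sup>2 * real (k + 2)\<rceil> \<le> N"
    have "real (2 * N + k + 1) \<le> real (k + 2) * real (Suc N)"
      by (simp add: algebra_simps)
    then have "l\<^sup>2 * real (2 * N + k + 1) \<le> l\<^sup>2 * (real (k + 2) * real (Suc N))"
      by (rule mult_left_mono) simp
    also have "\<dots> \<le> 1 / 2 * (real (Suc N))\<^sup>2"
    proof -
      have "2 * l\<^sup>2 * real (k + 2) \<le> real (Suc N)" using N by linarith
      then have "2 * l\<^sup>2 * real (k + 2) * real (Suc N) \<le> real (Suc N) * real (Suc N)"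
        by (rule mult_right_mono) simp
      then have "2 * (l\<^sup>2 * (real (k + 2) * real (Suc N))) \<le> (real (Suc N))\<^sup>2"
        by (simp only: power2_eq_square mult.assoc)
      then show ?thesis by linarith
    qed
    finally have "l\<^sup>2 * real (2 * N + k + 1) / (real (Suc N))\<^sup>2 \<le> 1 / 2"
      by (subst pos_divide_le_eq) auto
    then show "norm (x (Suc N)) \<le> 1 / 2 * norm (x N)"
      unfolding rec norm_mult by (intro mult_right_mono) auto
  qed simp
  then show ?case unfolding eq by (rule summable_LIMSEQ_zero)
next
  case (add q r)
  then show ?case using tendsto_add[OF add] by (simp add: distrib_left gauss_add)
next
  case (smult c q)
  then show ?case using tendsto_mult_left[OF smult, of c] by (simp add: gauss_smult)
qed

lemma std_normal_integrable_bounded: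
  assumes [measurable]: "f \<in> borel_measurable borel" and C: "\<And>u. \<bar>f u\<bar> \<le> C"
  shows "integrable std_normal_distribution (\<lambda>u. f u :: real)"
    and "integrable std_normal_distribution (\<lambda>u. f u * poly q u)"
    and "integrable std_normal_distribution (\<lambda>u. (f u - poly q u)\<^sup>2)"
proof -
  interpret prob_space std_normal_distribution by simp
  have b: "integrable std_normal_distribution g" if "g \<in> borel_measurable borel" "\<And>u. \<bar>g u\<bar> \<le> D"
    for g :: "real \<Rightarrow> real" and D
    by (rule integrable_const_bound[of _ D]) (use that in auto)
  show "integrable std_normal_distribution f" by (rule b[of _ C]) (use C in auto)
  have C0: "0 \<le> C" using C[of 0] by linarith
  show p: "integrable std_normal_distribution (\<lambda>u. f u * poly q u)"
  proof (rule Bochner_Integration.integrable_bound[of _ "\<lambda>u. C * poly q u"])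
    show "AE u in std_normal_distribution. norm (f u * poly q u) \<le> norm (C * poly q u)"
      using C C0 by (auto simp: abs_mult intro!: mult_right_mono)
  qed auto
  have "integrable std_normal_distribution (\<lambda>u. f u * f u - 2 * (f u * poly q u) + poly (q * q) u)"
  proof (intro Bochner_Integration.integrable_add Bochner_Integration.integrable_diff
      integrable_mult_right p std_normal_integrable_poly)
    show "integrable std_normal_distribution (\<lambda>u. f u * f u)"
    proof (rule b[of _ "C * C"])
      show "\<bar>f u * f u\<bar> \<le> C * C" for u
        using mult_mono[OF C C C0 abs_ge_zero] by (simp only: abs_mult)
    qed simp
  qed
  then show "integrable std_normal_distribution (\<lambda>u. (f u - poly q u)\<^sup>2)"
    by (simp add: power2_eq_square algebra_simps)
qed

text \<open>Membership in the closure of the polynomials in mean square. The integral of a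
  nonintegrable function is 0, so the notion is meaningful only for square integrable
  \<open>f\<close>; it is applied to bounded measurable functions.\<close>

definition poly_approximable :: "(real \<Rightarrow> real) \<Rightarrow> bool" where
  "poly_approximable f \<longleftrightarrow>
     (\<forall>\<epsilon>>0. \<exists>q. (\<integral>u. (f u - poly q u)\<^sup>2 \<partial>std_normal_distribution) < \<epsilon>)"

text \<open>One Horner step for a polynomial in \<open>sin (l * u)\<close>. As the sine is bounded
  by 1, multiplying by it does not amplify the error of the approximation to \<open>f\<close>; what
  remains is to replace the sine by a Taylor polynomial in front of a fixed
  \<open>q\<close>.\<close>

lemma poly_approximable_sin_mult:
  assumes f: "poly_approximable f" and [measurable]: "f \<in> borel_measurable borel"
    and C: "\<And>u. \<bar>f u\<bar> \<le> C"
  shows "poly_approximable (\<lambda>u. a + sin (l * u) * f u)"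
  unfolding poly_approximable_def
proof (intro allI impI)
  fix \<epsilon> :: real assume \<epsilon>: "0 < \<epsilon>"
  from f \<epsilon> obtain q where q: "(\<integral>u. (f u - poly q u)\<^sup>2 \<partial>std_normal_distribution) < \<epsilon> / 4"
    unfolding poly_approximable_def by (meson zero_less_divide_iff zero_less_numeral)
  \<comment> \<open>The squared Taylor remainder bound times the square of \<open>q\<close>. The
    degree \<open>N\<close> can be chosen only after \<open>q\<close>, because \<open>q\<close> is
    unbounded.\<close>
  let ?E = "\<lambda>N. monom (l ^ (2 * N) / (fact N)\<^sup>2) (2 * N) * (q * q)"
  have "eventually (\<lambda>N. gauss (?E N) < \<epsilon> / 4) sequentially"
    using order_tendstoD(2)[OF gauss_monom_power_tendsto_0[of l "q * q"], of "\<epsilon> / 4"] \<epsilon> by simp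
  then obtain N where N: "gauss (?E N) < \<epsilon> / 4"
    by (auto simp: eventually_sequentially)
  define T where "T = (\<Sum>m<N. monom (sin_coeff m * l ^ m) m)"
  have T: "\<bar>sin (l * u) - poly T u\<bar> \<le> \<bar>l * u\<bar> ^ N / fact N" for u
  proof -
    have "poly T u = (\<Sum>m<N. sin_coeff m * (l * u) ^ m)"
      by (simp add: T_def poly_sum poly_monom power_mult_distrib mult_ac)
    then show ?thesis using Maclaurin_sin_bound[of "l * u" N] by (simp add: divide_inverse mult.commute)
  qed
  define q' where "q' = [:a:] + T * q"
  have le: "(a + sin (l * u) * f u - poly q' u)\<^sup>2 \<le> 2 * (f u - poly q u)\<^sup>2 + 2 * poly (?E N) u" for u
  proof -
    have sq: "(x + y)\<^sup>2 \<le> 2 * x\<^sup>2 + 2 * y\<^sup>2" for x y :: real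
      using sum_squares_bound[of x y] by (simp add: power2_sum)
    have "(sin (l * u) * (f u - poly q u))\<^sup>2 \<le> 1 * (f u - poly q u)\<^sup>2"
      unfolding power_mult_distrib by (intro mult_right_mono) (auto simp: abs_square_le_1)
    moreover have "((sin (l * u) - poly T u) * poly q u)\<^sup>2 \<le> poly (?E N) u"
    proof -
      have "(sin (l * u) - poly T u)\<^sup>2 \<le> (\<bar>l * u\<bar> ^ N / fact N)\<^sup>2"
        using T[of u] by (simp add: abs_le_square_iff[symmetric])
      also have "\<dots> = l ^ (2 * N) * u ^ (2 * N) / (fact N)\<^sup>2"
        by (simp add: power_divide power_mult[symmetric] mult.commute[of N] power_mult_distrib
            flip: power_abs)
      finally have "(sin (l * u) - poly T u)\<^sup>2 * (poly q u)\<^sup>2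
          \<le> l ^ (2 * N) * u ^ (2 * N) / (fact N)\<^sup>2 * (poly q u)\<^sup>2"
        by (rule mult_right_mono) simp
      then show ?thesis
        by (simp add: power_mult_distrib poly_monom power2_eq_square[of "poly q u"])
    qed
    moreover have "a + sin (l * u) * f u - poly q' u
        = sin (l * u) * (f u - poly q u) + (sin (l * u) - poly T u) * poly q u"
      by (simp add: q'_def algebra_simps)
    ultimately show ?thesis
      by (simp only: mult_1) (intro order_trans[OF sq] add_mono mult_left_mono; simp)
  qed
  have "(\<integral>u. (a + sin (l * u) * f u - poly q' u)\<^sup>2 \<partial>std_normal_distribution)
      \<le> (\<integral>u. 2 * (f u - poly q u)\<^sup>2 + 2 * poly (?E N) u \<partial>std_normal_distribution)"
  proof (rule integral_mono)
    have "\<bar>a + sin (l * u) * f u\<bar> \<le> \<bar>a\<bar> + C" for u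
      using mult_mono[OF abs_sin_le_one[of "l * u"] C[of u]] abs_triangle_ineq[of a "sin (l * u) * f u"]
      by (simp add: abs_mult)
    then show "integrable std_normal_distribution (\<lambda>u. (a + sin (l * u) * f u - poly q' u)\<^sup>2)"
      by (intro std_normal_integrable_bounded) auto
    show "integrable std_normal_distribution (\<lambda>u. 2 * (f u - poly q u)\<^sup>2 + 2 * poly (?E N) u)"
      by (intro Bochner_Integration.integrable_add integrable_mult_right std_normal_integrable_poly
          std_normal_integrable_bounded(3)[of f C q, OF _ C]) auto
  qed (rule le)
  also have "\<dots> = 2 * (\<integral>u. (f u - poly q u)\<^sup>2 \<partial>std_normal_distribution) + 2 * gauss (?E N)"
    unfolding gauss_def
    by (subst Bochner_Integration.integral_add)
       (auto intro!: std_normal_integrable_bounded[OF _ C] std_normal_integrable_poly simp del: poly_mult)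
  also have "\<dots> < \<epsilon>" using q N by simp
  finally show "\<exists>q. (\<integral>u. (a + sin (l * u) * f u - poly q u)\<^sup>2 \<partial>std_normal_distribution) < \<epsilon>" ..
qed

lemma poly_bounded_unit_interval: "\<exists>C. \<forall>x::real. \<bar>x\<bar> \<le> 1 \<longrightarrow> \<bar>poly Q x\<bar> \<le> C"
proof -
  have "compact (poly Q ` {-1..1::real})"
    by (intro compact_continuous_image continuous_intros) simp
  then obtain C where "\<And>x. x \<in> {-1..1} \<Longrightarrow> \<bar>poly Q x\<bar> \<le> C"
    using compact_imp_bounded[of "poly Q ` {-1..1}"] unfolding bounded_iff by force
  then show ?thesis by (intro exI[of _ C]) (simp add: abs_le_iff)
qed

lemma poly_approximable_poly_sin: "poly_approximable (\<lambda>u. poly Q (sin (l * u)))"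
proof (induction Q)
  case 0
  show ?case by (auto simp: poly_approximable_def intro!: exI[of _ 0])
next
  case (pCons a Q)
  obtain C where "\<forall>x::real. \<bar>x\<bar> \<le> 1 \<longrightarrow> \<bar>poly Q x\<bar> \<le> C"
    using poly_bounded_unit_interval by blast
  then have "poly_approximable (\<lambda>u. a + sin (l * u) * poly Q (sin (l * u)))"
    by (intro poly_approximable_sin_mult[of _ C] pCons.IH) auto
  then show ?case by simp
qed

lemma poly_Weierstrass:
  fixes f :: "real \<Rightarrow> real"
  assumes "compact S" "continuous_on S f" "0 < e"
  obtains Q where "\<And>x. x \<in> S \<Longrightarrow> \<bar>f x - poly Q x\<bar> < e"
proof -
  obtain g where g: "real_polynomial_function g" "\<And>x. x \<in> S \<Longrightarrow> \<bar>f x - g x\<bar> < e"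
    using Stone_Weierstrass_real_polynomial_function[OF assms] by blast
  then obtain a n where an: "g = (\<lambda>x. \<Sum>i\<le>n. a i * x ^ i)"
    unfolding real_polynomial_function_iff_sum by blast
  have "g x = poly (\<Sum>i\<le>n. monom (a i) i) x" for x
    by (simp add: an poly_sum poly_monom)
  then show thesis using g(2) that by metis
qed

text \<open>On \<open>|u| \<le> \<rho>\<close> the map \<open>u \<mapsto> sin (l * u)\<close> is injective, so there \<open>h\<close> is uniformly close to a
  polynomial in \<open>sin (l * u)\<close>. Such a polynomial stays bounded outside, where Chebyshev's
  inequality controls the error.\<close>

lemma poly_approximable_continuous:
  assumes h: "continuous_on UNIV h" and C: "\<And>u. \<bar>h u\<bar> \<le> C"
  shows "poly_approximable h"
  unfolding poly_approximable_def
proof (intro allI impI)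
  fix \<epsilon> :: real assume \<epsilon>: "0 < \<epsilon>"
  have [measurable]: "h \<in> borel_measurable borel" by (rule borel_measurable_continuous_onI[OF h])
  have C0: "0 \<le> C" using C[of 0] by linarith
  \<comment> \<open>The final error is at most \<open>gauss ?B = 4 * e\<^sup>2\<close> plus twice
    \<open>\<epsilon> / 4\<close>; with this \<open>e\<close> both parts account for half of
    \<epsilon>.\<close>
  define e where "e = sqrt (\<epsilon> / 8)"
  have e: "0 < e" "e\<^sup>2 = \<epsilon> / 8" using \<epsilon> by (auto simp: e_def)
  \<comment> \<open>\<open>e * \<rho> = 2 * C + e\<close> bounds the error everywhere, so for
    \<open>\<bar>u\<bar>\<close> beyond \<rho> it is below \<open>e * \<bar>u\<bar>\<close>, whose
    square has Gaussian mean \<open>e\<^sup>2\<close>. Then \<open>l * \<rho> = pi / 2\<close> is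
    the end of the interval on which \<open>arcsin\<close> inverts the sine.\<close>
  define \<rho> where "\<rho> = (2 * C + e) / e"
  have \<rho>: "0 < \<rho>" using e C0 by (simp add: \<rho>_def)
  define l where "l = pi / (2 * \<rho>)"
  have l: "0 < l" using \<rho> by (simp add: l_def)
  have cont: "continuous_on {-1..1} (\<lambda>y. h (arcsin y / l))"
    using l by (intro continuous_on_compose2[OF h] continuous_intros) auto
  obtain Q where Q: "\<And>y. y \<in> {-1..1} \<Longrightarrow> \<bar>h (arcsin y / l) - poly Q y\<bar> < e"
    using poly_Weierstrass[OF _ cont e(1)] by auto
  let ?F = "\<lambda>u. poly Q (sin (l * u))"
  have F: "\<bar>?F u\<bar> \<le> C + e" for u
    using Q[of "sin (l * u)"] C[of "arcsin (sin (l * u)) / l"] by force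
  have close: "(h u - ?F u)\<^sup>2 \<le> e\<^sup>2 + e\<^sup>2 * u\<^sup>2" for u
  proof (cases "\<bar>u\<bar> \<le> \<rho>")
    case True
    have "\<bar>l * u\<bar> \<le> pi / 2"
    proof -
      have "\<bar>l * u\<bar> \<le> l * \<rho>" using True l by (simp add: abs_mult)
      then show ?thesis using \<rho> by (simp add: l_def)
    qed
    then have "arcsin (sin (l * u)) / l = u"
      using l by (subst arcsin_sin) auto
    then have "\<bar>h u - ?F u\<bar> \<le> e" using Q[of "sin (l * u)"] by force
    then have "(h u - ?F u)\<^sup>2 \<le> e\<^sup>2" using e(1) by (simp add: abs_le_square_iff[symmetric])
    then show ?thesis by (simp add: add_increasing2)
  next
    case False
    have "\<bar>h u - ?F u\<bar> \<le> e * \<rho>"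
      using C[of u] F[of u] e by (simp add: \<rho>_def)
    also have "\<dots> \<le> e * \<bar>u\<bar>" using False e by simp
    finally have "(h u - ?F u)\<^sup>2 \<le> (e * \<bar>u\<bar>)\<^sup>2" using e(1) by (simp add: abs_le_square_iff[symmetric] abs_mult)
    then show ?thesis by (simp add: power_mult_distrib add_increasing)
  qed
  obtain q where q: "(\<integral>u. (?F u - poly q u)\<^sup>2 \<partial>std_normal_distribution) < \<epsilon> / 4"
    using poly_approximable_poly_sin[of Q l] \<epsilon> unfolding poly_approximable_def
    by (meson zero_less_divide_iff zero_less_numeral)
  let ?B = "smult (2 * e\<^sup>2) (monom 1 0 + monom 1 2)"
  have "(\<integral>u. (h u - poly q u)\<^sup>2 \<partial>std_normal_distribution)
      \<le> (\<integral>u. poly ?B u + 2 * (?F u - poly q u)\<^sup>2 \<partial>std_normal_distribution)"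
  proof (rule integral_mono)
    show "integrable std_normal_distribution (\<lambda>u. (h u - poly q u)\<^sup>2)"
      by (rule std_normal_integrable_bounded[OF _ C]) simp
    show "integrable std_normal_distribution (\<lambda>u. poly ?B u + 2 * (?F u - poly q u)\<^sup>2)"
      by (intro Bochner_Integration.integrable_add integrable_mult_right std_normal_integrable_poly
          std_normal_integrable_bounded(3)[of ?F "C + e" q, OF _ F]) auto
    fix u
    have "(h u - poly q u)\<^sup>2 \<le> 2 * (h u - ?F u)\<^sup>2 + 2 * (?F u - poly q u)\<^sup>2"
      using sum_squares_bound[of "h u - ?F u" "?F u - poly q u"]
        power2_sum[of "h u - ?F u" "?F u - poly q u"] by simp
    then show "(h u - poly q u)\<^sup>2 \<le> poly ?B u + 2 * (?F u - poly q u)\<^sup>2"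
      using close[of u] by (simp add: poly_monom algebra_simps)
  qed
  also have "\<dots> = gauss ?B + 2 * (\<integral>u. (?F u - poly q u)\<^sup>2 \<partial>std_normal_distribution)"
    unfolding gauss_def
    by (subst Bochner_Integration.integral_add)
       (auto intro!: std_normal_integrable_bounded[of ?F "C + e", OF _ F] std_normal_integrable_poly
         simp del: poly_smult poly_add)
  also have "gauss ?B = 4 * e\<^sup>2"
    using gauss_monom_even[of 0] gauss_monom_even[of 1] by (simp add: gauss_smult gauss_add)
  finally show "\<exists>q. (\<integral>u. (h u - poly q u)\<^sup>2 \<partial>std_normal_distribution) < \<epsilon>"
    using q e by (intro exI[of _ q]) simp
qed

section \<open>Hermite coefficients: Bessel's inequality and Parseval's identity\<close>

definition hermite_coeff :: "(real \<Rightarrow> real) \<Rightarrow> nat \<Rightarrow> real" where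
  "hermite_coeff f j = (\<integral>u. f u * hermite_psi j u \<partial>std_normal_distribution)"

text \<open>Pythagoras for arbitrary coefficients \<open>c\<close>. Taking \<open>c\<close> to be
  the Hermite coefficients gives Bessel's inequality; comparing this choice with any other shows
  that it is the best approximation of its degree.\<close>

lemma hermite_expansion_error:
  assumes [measurable]: "f \<in> borel_measurable borel" and C: "\<And>u. \<bar>f u\<bar> \<le> C"
  shows "(\<integral>u. (f u - (\<Sum>j\<le>n. c j * hermite_psi j u))\<^sup>2 \<partial>std_normal_distribution)
    = (\<integral>u. (f u)\<^sup>2 \<partial>std_normal_distribution) - (\<Sum>j\<le>n. (hermite_coeff f j)\<^sup>2)
      + (\<Sum>j\<le>n. (hermite_coeff f j - c j)\<^sup>2)"
proof -
  have if2: "integrable std_normal_distribution (\<lambda>u. (f u)\<^sup>2)"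
    using std_normal_integrable_bounded(3)[of f C 0, OF _ C] by simp
  have ifp: "integrable std_normal_distribution (\<lambda>u. f u * hermite_psi j u)" for j
    using std_normal_integrable_bounded(2)[of f C "hermite_psi_poly j", OF _ C] by (simp add: hermite_psi_eq_poly)
  have ipp: "integrable std_normal_distribution (\<lambda>u. hermite_psi i u * hermite_psi j u)" for i j
    using std_normal_integrable_poly[of "hermite_psi_poly i * hermite_psi_poly j"]
    by (subst (asm) poly_mult[abs_def]) (simp add: hermite_psi_eq_poly)
  have "(f u - (\<Sum>j\<le>n. c j * hermite_psi j u))\<^sup>2
      = (f u)\<^sup>2 - (\<Sum>j\<le>n. 2 * c j * (f u * hermite_psi j u))
        + (\<Sum>i\<le>n. \<Sum>j\<le>n. c i * c j * (hermite_psi i u * hermite_psi j u))" for u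
    by (simp add: power2_diff power2_eq_square[of "sum _ _"] sum_product sum_distrib_left mult_ac)
  then have "(\<integral>u. (f u - (\<Sum>j\<le>n. c j * hermite_psi j u))\<^sup>2 \<partial>std_normal_distribution)
    = (\<integral>u. (f u)\<^sup>2 \<partial>std_normal_distribution) - (\<Sum>j\<le>n. 2 * c j * hermite_coeff f j)
      + (\<Sum>i\<le>n. \<Sum>j\<le>n. c i * c j * (if i = j then 1 else 0))"
    by (simp add: if2 ifp ipp Bochner_Integration.integral_sum hermite_coeff_def hermite_psi_orthonormal)
  also have "(\<Sum>i\<le>n. \<Sum>j\<le>n. c i * c j * (if i = j then 1 else 0)) = (\<Sum>i\<le>n. (c i)\<^sup>2)"
    by (intro sum.cong) (simp_all add: power2_eq_square if_distrib cong: if_cong)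
  finally show ?thesis
    by (simp add: power2_diff sum.distrib sum_subtractf mult_ac)
qed

lemma hermite_coeff_tendsto_0:
  assumes [measurable]: "f \<in> borel_measurable borel" and C: "\<And>u. \<bar>f u\<bar> \<le> C"
  shows "hermite_coeff f \<longlonglongrightarrow> 0"
proof -
  have "(\<Sum>j<n. (hermite_coeff f j)\<^sup>2) \<le> (\<integral>u. (f u)\<^sup>2 \<partial>std_normal_distribution)" for n
  proof -
    have "0 \<le> (\<integral>u. (f u - (\<Sum>j\<le>n. hermite_coeff f j * hermite_psi j u))\<^sup>2 \<partial>std_normal_distribution)"
      by simp
    then have "(\<Sum>j\<le>n. (hermite_coeff f j)\<^sup>2) \<le> (\<integral>u. (f u)\<^sup>2 \<partial>std_normal_distribution)"
      by (subst (asm) hermite_expansion_error[OF _ C]) auto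
    moreover have "(\<Sum>j<n. (hermite_coeff f j)\<^sup>2) \<le> (\<Sum>j\<le>n. (hermite_coeff f j)\<^sup>2)"
      by (intro sum_mono2) auto
    ultimately show ?thesis by linarith
  qed
  then have "summable (\<lambda>j. (hermite_coeff f j)\<^sup>2)"
    by (intro summableI_nonneg_bounded[where x="\<integral>u. (f u)\<^sup>2 \<partial>std_normal_distribution"]) auto
  then have "(\<lambda>j. (hermite_coeff f j)\<^sup>2) \<longlonglongrightarrow> 0" by (rule summable_LIMSEQ_zero)
  then have "(\<lambda>j. sqrt ((hermite_coeff f j)\<^sup>2)) \<longlonglongrightarrow> 0" using tendsto_real_sqrt by fastforce
  then show ?thesis by (simp add: tendsto_rabs_zero_iff)
qed

lemma hermite_expansion_tendsto:
  assumes h: "continuous_on UNIV h" and C: "\<And>u. \<bar>h u\<bar> \<le> C"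
  shows "(\<lambda>n. \<integral>u. (h u - (\<Sum>j\<le>n. hermite_coeff h j * hermite_psi j u))\<^sup>2 \<partial>std_normal_distribution)
    \<longlonglongrightarrow> 0"
proof (rule LIMSEQ_I)
  fix \<epsilon> :: real assume "0 < \<epsilon>"
  have [measurable]: "h \<in> borel_measurable borel" by (rule borel_measurable_continuous_onI[OF h])
  obtain q where q: "(\<integral>u. (h u - poly q u)\<^sup>2 \<partial>std_normal_distribution) < \<epsilon>"
    using poly_approximable_continuous[OF h C] \<open>0 < \<epsilon>\<close> unfolding poly_approximable_def by blast
  \<comment> \<open>From the degree of \<open>q\<close> on, \<open>q\<close> competes with the
    Hermite expansion and loses.\<close>
  have "(\<integral>u. (h u - (\<Sum>j\<le>n. hermite_coeff h j * hermite_psi j u))\<^sup>2 \<partial>std_normal_distribution) < \<epsilon>"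
    if deg: "degree q \<le> n" for n
  proof -
    obtain c where c: "poly q = (\<lambda>u. \<Sum>j\<le>n. c j * hermite_psi j u)"
      using hermite_psi_span[OF deg] by blast
    have "(\<integral>u. (h u - (\<Sum>j\<le>n. hermite_coeff h j * hermite_psi j u))\<^sup>2 \<partial>std_normal_distribution)
        \<le> (\<integral>u. (h u - (\<Sum>j\<le>n. c j * hermite_psi j u))\<^sup>2 \<partial>std_normal_distribution)"
      by (subst (1 2) hermite_expansion_error[OF _ C]) (auto intro: sum_nonneg)
    then show ?thesis using q unfolding c by linarith
  qed
  then show "\<exists>no. \<forall>n\<ge>no. norm ((\<integral>u. (h u - (\<Sum>j\<le>n. hermite_coeff h j * hermite_psi j u))\<^sup>2
      \<partial>std_normal_distribution) - 0) < \<epsilon>"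
    by (intro exI[of _ "degree q"]) auto
qed

text \<open>The two functions play different roles. Mean square convergence of the expansion is used
  for the continuous \<open>h\<close> only; the merely bounded \<open>g\<close>, later built from
  the density, is paired with the remainder \<open>r n\<close>, whose norm tends to 0.\<close>

lemma hermite_parseval:
  assumes h: "continuous_on UNIV h" and C: "\<And>u. \<bar>h u\<bar> \<le> C"
    and g [measurable]: "g \<in> borel_measurable borel" and B: "\<And>u. \<bar>g u\<bar> \<le> B"
  shows "(\<lambda>n. \<Sum>j\<le>n. hermite_coeff h j * hermite_coeff g j)
    \<longlonglongrightarrow> (\<integral>u. h u * g u \<partial>std_normal_distribution)"
proof -
  interpret prob_space std_normal_distribution by simp
  have [measurable]: "h \<in> borel_measurable borel" by (rule borel_measurable_continuous_onI[OF h])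
  define r where "r n u = h u - (\<Sum>j\<le>n. hermite_coeff h j * hermite_psi j u)" for n u
  have [measurable]: "r n \<in> borel_measurable borel" for n unfolding r_def by measurable
  have C0: "0 \<le> C" using C[of 0] by linarith
  have B0: "0 \<le> B" using B[of 0] by linarith
  have igp: "integrable std_normal_distribution (\<lambda>u. hermite_psi j u * g u)" for j
    using std_normal_integrable_bounded(2)[of g B "hermite_psi_poly j", OF _ B]
    by (simp add: hermite_psi_eq_poly mult.commute)
  have ihg: "integrable std_normal_distribution (\<lambda>u. h u * g u)"
    using C B C0 B0 by (intro std_normal_integrable_bounded(1)[of _ "C * B"]) (auto simp: abs_mult intro!: mult_mono)
  have ir: "integrable std_normal_distribution (\<lambda>u. (r n u)\<^sup>2)" for n
    using std_normal_integrable_bounded(3)[of h C "\<Sum>j\<le>n. smult (hermite_coeff h j) (hermite_psi_poly j)", OF _ C]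
    by (simp add: r_def poly_sum poly_hermite_psi_poly)
  have rg: "r n u * g u = h u * g u - (\<Sum>j\<le>n. hermite_coeff h j * (hermite_psi j u * g u))" for n u
    by (simp add: r_def left_diff_distrib sum_distrib_right mult.assoc)
  have irg: "integrable std_normal_distribution (\<lambda>u. r n u * g u)" for n
    unfolding rg by (intro Bochner_Integration.integrable_diff ihg Bochner_Integration.integrable_sum
        integrable_mult_right igp)
  have eq: "(\<integral>u. r n u * g u \<partial>std_normal_distribution) = (\<integral>u. h u * g u \<partial>std_normal_distribution)
      - (\<Sum>j\<le>n. hermite_coeff h j * hermite_coeff g j)" for n
    unfolding rg
    by (simp add: ihg igp Bochner_Integration.integral_sum hermite_coeff_def mult.commute[of "g _"])
  have bnd: "(r n u * g u)\<^sup>2 \<le> B\<^sup>2 * (r n u)\<^sup>2" for n u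
  proof -
    have "(g u)\<^sup>2 \<le> B\<^sup>2" using B[of u] B0 by (simp add: abs_le_square_iff[symmetric])
    then show ?thesis by (simp add: power_mult_distrib mult.commute mult_right_mono)
  qed
  have "((\<integral>u. r n u * g u \<partial>std_normal_distribution))\<^sup>2 \<le> B\<^sup>2 * (\<integral>u. (r n u)\<^sup>2 \<partial>std_normal_distribution)" for n
  proof -
    have i2: "integrable std_normal_distribution (\<lambda>u. (r n u * g u)\<^sup>2)"
      by (rule Bochner_Integration.integrable_bound[OF integrable_mult_right[OF ir, of "B\<^sup>2" n]])
         (use bnd in auto)
    \<comment> \<open>Nonnegativity of the variance is Jensen's inequality for the square.\<close>
    have "(\<integral>u. r n u * g u \<partial>std_normal_distribution)\<^sup>2 \<le> (\<integral>u. (r n u * g u)\<^sup>2 \<partial>std_normal_distribution)"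
      using variance_positive[of "\<lambda>u. r n u * g u"] variance_eq[OF irg i2] by simp
    also have "\<dots> \<le> (\<integral>u. B\<^sup>2 * (r n u)\<^sup>2 \<partial>std_normal_distribution)"
      by (intro integral_mono i2 integrable_mult_right ir bnd)
    finally show ?thesis by simp
  qed
  moreover have "(\<lambda>n. B\<^sup>2 * (\<integral>u. (r n u)\<^sup>2 \<partial>std_normal_distribution)) \<longlonglongrightarrow> 0"
    using tendsto_mult_left[OF hermite_expansion_tendsto[OF h C], of "B\<^sup>2"] by (simp add: r_def)
  ultimately have "(\<lambda>n. (\<integral>u. r n u * g u \<partial>std_normal_distribution)\<^sup>2) \<longlonglongrightarrow> 0"
    by (rule_tac tendsto_sandwich[of "\<lambda>_. 0"]) auto
  then have "(\<lambda>n. sqrt ((\<integral>u. r n u * g u \<partial>std_normal_distribution)\<^sup>2)) \<longlonglongrightarrow> 0"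
    using tendsto_real_sqrt by fastforce
  then have "(\<lambda>n. \<integral>u. r n u * g u \<partial>std_normal_distribution) \<longlonglongrightarrow> 0"
    by (simp add: tendsto_rabs_zero_iff)
  then have "(\<lambda>n. (\<integral>u. h u * g u \<partial>std_normal_distribution) - (\<integral>u. r n u * g u \<partial>std_normal_distribution))
      \<longlonglongrightarrow> (\<integral>u. h u * g u \<partial>std_normal_distribution) - 0"
    by (intro tendsto_intros)
  then show ?thesis by (simp add: eq)
qed

section \<open>Convergence in outer probability\<close>

lemma outer_measure_of_Un_le:
  assumes "A \<subseteq> space M" "B \<subseteq> space M"
  shows "outer_measure_of M (A \<union> B) \<le> outer_measure_of M A + outer_measure_of M B"
proof -
  obtain E where E: "E \<in> sets M" "A \<subseteq> E" "outer_measure_of M A = emeasure M E"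
    using outer_measure_of_attain[OF assms(1)] by blast
  obtain F where F: "F \<in> sets M" "B \<subseteq> F" "outer_measure_of M B = emeasure M F"
    using outer_measure_of_attain[OF assms(2)] by blast
  have "outer_measure_of M (A \<union> B) \<le> outer_measure_of M (E \<union> F)"
    using E F by (intro outer_measure_of_mono) auto
  also have "\<dots> \<le> emeasure M E + emeasure M F"
    using E F by (simp add: emeasure_subadditive)
  finally show ?thesis using E F by simp
qed

lemma tendsto_ennreal_0I:
  assumes "\<And>\<eta>. 0 < \<eta> \<Longrightarrow> eventually (\<lambda>n. f n \<le> ennreal \<eta>) F"
  shows "(f \<longlongrightarrow> (0::ennreal)) F"
proof (rule order_tendstoI)
  fix a :: ennreal assume "0 < a"
  then obtain b where b: "0 < b" "b < a" using dense by blast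
  then obtain \<eta> where \<eta>: "b = ennreal \<eta>" "0 < \<eta>"
    by (cases b) (auto simp: top_unique[symmetric] less_top[symmetric])
  from assms[OF \<eta>(2)] show "eventually (\<lambda>n. f n < a) F"
    by eventually_elim (use b \<eta> in auto)
qed auto

lemma converges_in_probD:
  assumes "converges_in_prob M X c" "0 < \<epsilon>" "0 < \<eta>"
  shows "eventually (\<lambda>n. outer_measure_of (M n) {\<omega> \<in> space (M n). \<epsilon> < \<bar>X n \<omega> - c\<bar>} \<le> ennreal \<eta>) sequentially"
proof -
  have "(\<lambda>n. outer_measure_of (M n) {\<omega> \<in> space (M n). \<epsilon> < \<bar>X n \<omega> - c\<bar>}) \<longlonglongrightarrow> 0"
    using assms unfolding converges_in_prob_def by blast
  from order_tendstoD(2)[OF this, of "ennreal \<eta>"] assms(3) show ?thesis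
    by (auto elim!: eventually_mono intro: less_imp_le)
qed

text \<open>Continuity at the limit point alone suffices. In the application \<open>f\<close> is a
  quotient: outcomes where the random denominator is near 0 lie away from the limit and have
  vanishing outer probability.\<close>

lemma converges_in_prob_continuous2:
  assumes X: "converges_in_prob M X a" and Y: "converges_in_prob M Y b"
    and f: "isCont (\<lambda>(x, y). f x y) (a, b)"
  shows "converges_in_prob M (\<lambda>n \<omega>. f (X n \<omega>) (Y n \<omega>)) (f a b :: real)"
  unfolding converges_in_prob_def
proof (intro allI impI tendsto_ennreal_0I)
  fix \<epsilon> \<eta> :: real assume \<epsilon>: "0 < \<epsilon>" and \<eta>: "0 < \<eta>"
  obtain d where d: "0 < d" "\<And>x y. dist (x, y) (a, b) < d \<Longrightarrow> dist (f x y) (f a b) < \<epsilon>"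
    using f \<epsilon> unfolding continuous_at_eps_delta by fastforce
  \<comment> \<open>Thirds instead of halves: off the bad events only weak inequalities hold,
    whereas continuity asks for a distance strictly below \<open>d\<close>.\<close>
  have close: "\<bar>f x y - f a b\<bar> \<le> \<epsilon>" if "\<bar>x - a\<bar> \<le> d / 3" "\<bar>y - b\<bar> \<le> d / 3" for x y
  proof -
    have "dist (x, y) (a, b) \<le> dist x a + dist y b"
      by (simp add: dist_prod_def sqrt_sum_squares_le_sum)
    then have "dist (x, y) (a, b) < d" using that d(1) by (simp add: dist_real_def)
    from d(2)[OF this] show ?thesis by (simp add: dist_real_def)
  qed
  have "0 < d / 3" "0 < \<eta> / 2" using d \<eta> by auto
  from converges_in_probD[OF X this] converges_in_probD[OF Y this]
  show "eventually (\<lambda>n. outer_measure_of (M n) {\<omega> \<in> space (M n). \<epsilon> < \<bar>f (X n \<omega>) (Y n \<omega>) - f a b\<bar>}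
      \<le> ennreal \<eta>) sequentially"
  proof eventually_elim
    case (elim n)
    let ?A = "{\<omega> \<in> space (M n). d / 3 < \<bar>X n \<omega> - a\<bar>}"
    let ?B = "{\<omega> \<in> space (M n). d / 3 < \<bar>Y n \<omega> - b\<bar>}"
    have "outer_measure_of (M n) {\<omega> \<in> space (M n). \<epsilon> < \<bar>f (X n \<omega>) (Y n \<omega>) - f a b\<bar>}
        \<le> outer_measure_of (M n) (?A \<union> ?B)"
      using close by (intro outer_measure_of_mono) (fastforce simp: not_le[symmetric])
    also have "\<dots> \<le> outer_measure_of (M n) ?A + outer_measure_of (M n) ?B"
      by (intro outer_measure_of_Un_le) auto
    also have "\<dots> \<le> ennreal (\<eta> / 2) + ennreal (\<eta> / 2)" using elim by (intro add_mono)
    also have "\<dots> = ennreal \<eta>" using \<eta> by (simp flip: ennreal_plus)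
    finally show ?case .
  qed
qed

text \<open>Chebyshev's inequality about the moving centre \<open>m n\<close>, whose distance from
  \<open>T\<close> is a deterministic bias. The conditions are eventual because an empty sample has
  to be excluded.\<close>

lemma converges_in_prob_second_moment:
  assumes M: "\<And>n. prob_space (M n)"
    and S: "eventually (\<lambda>n. S n \<in> borel_measurable (M n) \<and> integrable (M n) (\<lambda>\<omega>. (S n \<omega> - m n)\<^sup>2)
      \<and> (\<integral>\<omega>. (S n \<omega> - m n)\<^sup>2 \<partial>M n) \<le> v n) sequentially"
    and v: "v \<longlonglongrightarrow> 0" and m: "m \<longlonglongrightarrow> T"
  shows "converges_in_prob M S T"
  unfolding converges_in_prob_def
proof (intro allI impI tendsto_ennreal_0I)
  fix \<epsilon> \<eta> :: real assume \<epsilon>: "0 < \<epsilon>" and \<eta>: "0 < \<eta>"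
  have 1: "eventually (\<lambda>n. \<bar>m n - T\<bar> < \<epsilon> / 2) sequentially"
    using tendstoD[OF m, of "\<epsilon> / 2"] \<epsilon> by (simp add: dist_real_def)
  have 2: "eventually (\<lambda>n. v n < \<eta> * (\<epsilon> / 2)\<^sup>2) sequentially"
    using v \<epsilon> \<eta> by (intro order_tendstoD(2)[of _ 0]) auto
  from S 1 2 show "eventually (\<lambda>n. outer_measure_of (M n) {\<omega> \<in> space (M n). \<epsilon> < \<bar>S n \<omega> - T\<bar>} \<le> ennreal \<eta>) sequentially"
  proof eventually_elim
    case (elim n)
    interpret prob_space "M n" by (rule M)
    have [measurable]: "S n \<in> borel_measurable (M n)" using elim by simp
    let ?A = "{\<omega> \<in> space (M n). (\<epsilon> / 2)\<^sup>2 \<le> (S n \<omega> - m n)\<^sup>2}"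
    have "outer_measure_of (M n) {\<omega> \<in> space (M n). \<epsilon> < \<bar>S n \<omega> - T\<bar>} \<le> outer_measure_of (M n) ?A"
    proof (intro outer_measure_of_mono subsetI, clarsimp)
      fix \<omega> assume "\<epsilon> < \<bar>S n \<omega> - T\<bar>"
      then have "\<bar>\<epsilon> / 2\<bar> \<le> \<bar>S n \<omega> - m n\<bar>" using elim \<epsilon> by linarith
      then show "(\<epsilon> / 2)\<^sup>2 \<le> (S n \<omega> - m n)\<^sup>2" by (simp only: abs_le_square_iff)
    qed
    also have "\<dots> = emeasure (M n) ?A" by (intro outer_measure_of_eq) measurable
    also have "\<dots> = ennreal (prob ?A)" by (simp add: emeasure_eq_measure)
    also have "prob ?A \<le> (\<integral>\<omega>. (S n \<omega> - m n)\<^sup>2 \<partial>M n) / (\<epsilon> / 2)\<^sup>2"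
      using elim \<epsilon> by (intro integral_Markov_inequality_measure[where A = "{}"]) auto
    also have "\<dots> \<le> \<eta>" using elim \<epsilon> by (simp add: pos_divide_le_eq del: power_divide)
    finally show ?case by (simp add: ennreal_leI)
  qed
qed

text \<open>The possibly nonmeasurable factor \<open>X\<close> is cut off at a constant with small
  outer probability, and Markov's inequality handles the integrable factor \<open>Q\<close>. The two
  may depend on each other, as they do when an estimator is computed from the same sample.\<close>

lemma converges_in_prob_perturb:
  assumes M: "\<And>n. prob_space (M n)" and R: "converges_in_prob M R T"
    and X: "bounded_in_prob M X"
    and Q: "eventually (\<lambda>n. integrable (M n) (Q n) \<and> (\<forall>\<omega>\<in>space (M n). 0 \<le> Q n \<omega>)
      \<and> (\<integral>\<omega>. Q n \<omega> \<partial>M n) \<le> v n) sequentially"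
    and v: "v \<longlonglongrightarrow> 0"
    and S: "eventually (\<lambda>n. \<forall>\<omega>\<in>space (M n). \<bar>S n \<omega> - R n \<omega>\<bar> \<le> \<bar>X n \<omega>\<bar> * Q n \<omega>) sequentially"
  shows "converges_in_prob M S T"
  unfolding converges_in_prob_def
proof (intro allI impI tendsto_ennreal_0I)
  fix \<epsilon> \<eta> :: real assume \<epsilon>: "0 < \<epsilon>" and \<eta>: "0 < \<eta>"
  obtain K' where K': "eventually (\<lambda>n. outer_measure_of (M n) {\<omega> \<in> space (M n). K' < \<bar>X n \<omega>\<bar>} \<le> ennreal (\<eta> / 3)) sequentially"
    using X \<eta> unfolding bounded_in_prob_def by (meson zero_less_divide_iff zero_less_numeral)
  \<comment> \<open>\<open>K'\<close> could be 0 or negative; the maximum makes division by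
    \<open>K\<close> legitimate.\<close>
  define K where "K = max K' 1"
  have K: "0 < K" "K' \<le> K" by (auto simp: K_def)
  have 1: "eventually (\<lambda>n. outer_measure_of (M n) {\<omega> \<in> space (M n). \<epsilon> / 2 < \<bar>R n \<omega> - T\<bar>} \<le> ennreal (\<eta> / 3)) sequentially"
    using \<epsilon> \<eta> by (intro converges_in_probD[OF R]) auto
  have 2: "eventually (\<lambda>n. v n < \<eta> / 3 * (\<epsilon> / (2 * K))) sequentially"
    using v \<epsilon> \<eta> K by (intro order_tendstoD(2)[of _ 0]) auto
  from Q S K' 1 2
  show "eventually (\<lambda>n. outer_measure_of (M n) {\<omega> \<in> space (M n). \<epsilon> < \<bar>S n \<omega> - T\<bar>} \<le> ennreal \<eta>) sequentially"
  proof eventually_elim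
    case (elim n)
    interpret prob_space "M n" by (rule M)
    have iQ: "integrable (M n) (Q n)" using elim by simp
    then have [measurable]: "Q n \<in> borel_measurable (M n)" by simp
    let ?A = "{\<omega> \<in> space (M n). \<epsilon> / 2 < \<bar>R n \<omega> - T\<bar>}"
    let ?B = "{\<omega> \<in> space (M n). K' < \<bar>X n \<omega>\<bar>}"
    let ?C = "{\<omega> \<in> space (M n). \<epsilon> / (2 * K) \<le> Q n \<omega>}"
    have "outer_measure_of (M n) {\<omega> \<in> space (M n). \<epsilon> < \<bar>S n \<omega> - T\<bar>} \<le> outer_measure_of (M n) (?A \<union> (?B \<union> ?C))"
    proof (intro outer_measure_of_mono subsetI)
      fix \<omega> assume "\<omega> \<in> {\<omega> \<in> space (M n). \<epsilon> < \<bar>S n \<omega> - T\<bar>}"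
      then have \<omega>: "\<omega> \<in> space (M n)" "\<epsilon> < \<bar>S n \<omega> - T\<bar>" by auto
      show "\<omega> \<in> ?A \<union> (?B \<union> ?C)"
      proof (rule ccontr)
        assume "\<omega> \<notin> ?A \<union> (?B \<union> ?C)"
        then have n: "\<bar>R n \<omega> - T\<bar> \<le> \<epsilon> / 2" "\<bar>X n \<omega>\<bar> \<le> K" "Q n \<omega> \<le> \<epsilon> / (2 * K)"
          using \<omega> K by auto
        have "\<bar>S n \<omega> - R n \<omega>\<bar> \<le> \<bar>X n \<omega>\<bar> * Q n \<omega>" using elim \<omega> by blast
        also have "\<dots> \<le> K * (\<epsilon> / (2 * K))" using n elim \<omega> K by (intro mult_mono) auto
        also have "\<dots> = \<epsilon> / 2" using K by simp
        finally show False using n \<omega> by linarith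
      qed
    qed
    also have "\<dots> \<le> outer_measure_of (M n) ?A + (outer_measure_of (M n) ?B + outer_measure_of (M n) ?C)"
      by (intro order_trans[OF outer_measure_of_Un_le] add_left_mono outer_measure_of_Un_le) auto
    also have "outer_measure_of (M n) ?C = emeasure (M n) ?C" by (intro outer_measure_of_eq) measurable
    also have "\<dots> = ennreal (prob ?C)" by (simp add: emeasure_eq_measure)
    also have "prob ?C \<le> (\<integral>\<omega>. Q n \<omega> \<partial>M n) / (\<epsilon> / (2 * K))"
      using elim \<epsilon> K by (intro integral_Markov_inequality_measure[where A = "{}"]) auto
    also have "\<dots> \<le> \<eta> / 3" using elim \<epsilon> K by (subst pos_divide_le_eq) auto
    also have "outer_measure_of (M n) ?A + (outer_measure_of (M n) ?B + ennreal (\<eta> / 3))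
        \<le> ennreal (\<eta> / 3) + (ennreal (\<eta> / 3) + ennreal (\<eta> / 3))"
      using elim by (intro add_mono) auto
    also have "\<dots> = ennreal \<eta>" using \<eta> by (simp flip: ennreal_plus)
    finally show ?case by (simp add: ennreal_leI add_left_mono)
  qed
qed

section \<open>Averages of observations grouped in articles\<close>

text \<open>Independence is given for the vectors of whole articles. Restricting the family to the
  two articles concerned and reading off one coordinate of each yields the pair.\<close>

lemma indep_across_articles_indep_var:
  fixes f g :: "real \<Rightarrow> real"
  assumes M: "prob_space M" and ind: "indep_across_articles M n art Z"
    and ik: "i \<in> {1..n}" "k \<in> {1..n}" "art i \<noteq> art k"
    and fg: "f \<in> borel_measurable borel" "g \<in> borel_measurable borel"
  shows "prob_space.indep_var M borel (\<lambda>\<omega>. f (Z i \<omega>)) borel (\<lambda>\<omega>. g (Z k \<omega>))"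
proof -
  interpret prob_space M by (rule M)
  let ?P = "\<lambda>a. \<Pi>\<^sub>M i \<in> article_obs n art a. (borel :: real measure)"
  let ?X = "\<lambda>a \<omega>. \<lambda>i \<in> article_obs n art a. Z i \<omega>"
  have "indep_var (PiM {art i} ?P) (\<lambda>\<omega>. restrict (\<lambda>a. ?X a \<omega>) {art i})
      (PiM {art k} ?P) (\<lambda>\<omega>. restrict (\<lambda>a. ?X a \<omega>) {art k})"
    using ind ik unfolding indep_across_articles_def by (intro indep_var_restrict) auto
  note ind2 = this
  have meas: "(\<lambda>x. f (x (art i) i)) \<in> measurable (PiM {art i} ?P) borel"
    if "i \<in> {1..n}" "f \<in> borel_measurable borel" for f :: "real \<Rightarrow> real" and i
  proof (rule measurable_compose[OF _ that(2)])
    have "(\<lambda>x. x (art i)) \<in> measurable (PiM {art i} ?P) (?P (art i))"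
      by (rule measurable_component_singleton) simp
    moreover have "(\<lambda>y. y i) \<in> measurable (?P (art i)) (borel :: real measure)"
      using that by (intro measurable_component_singleton) (simp add: article_obs_def)
    ultimately show "(\<lambda>x. x (art i) i) \<in> measurable (PiM {art i} ?P) borel"
      by (rule measurable_compose)
  qed
  have "indep_var borel ((\<lambda>x. f (x (art i) i)) \<circ> (\<lambda>\<omega>. restrict (\<lambda>a. ?X a \<omega>) {art i}))
     borel ((\<lambda>x. g (x (art k) k)) \<circ> (\<lambda>\<omega>. restrict (\<lambda>a. ?X a \<omega>) {art k}))"
    by (rule indep_var_compose[OF ind2 meas[OF ik(1) fg(1)] meas[OF ik(2) fg(2)]])
  then show ?thesis using ik by (simp add: comp_def article_obs_def)
qed

text \<open>At most \<open>n * L\<close> pairs of observations come from the same article, and all others are uncorrelated.\<close>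

lemma article_mean_variance:
  fixes Y :: "real \<Rightarrow> real"
  assumes M: "prob_space M" and ind: "indep_across_articles M n art Z"
    and L: "\<And>a. card (article_obs n art a) \<le> L" and n: "1 \<le> n"
    and Z: "\<And>i. i \<in> {1..n} \<Longrightarrow> Z i \<in> borel_measurable M"
    and Y [measurable]: "Y \<in> borel_measurable borel"
    and i1: "\<And>i. i \<in> {1..n} \<Longrightarrow> integrable M (\<lambda>\<omega>. Y (Z i \<omega>))"
    and i2: "\<And>i. i \<in> {1..n} \<Longrightarrow> integrable M (\<lambda>\<omega>. (Y (Z i \<omega>))\<^sup>2)"
    and m: "\<And>i. i \<in> {1..n} \<Longrightarrow> (\<integral>\<omega>. Y (Z i \<omega>) \<partial>M) = m"
    and V: "\<And>i. i \<in> {1..n} \<Longrightarrow> (\<integral>\<omega>. (Y (Z i \<omega>))\<^sup>2 \<partial>M) \<le> V"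
  shows "integrable M (\<lambda>\<omega>. ((\<Sum>i=1..n. Y (Z i \<omega>)) / real n - m)\<^sup>2)"
    and "(\<integral>\<omega>. ((\<Sum>i=1..n. Y (Z i \<omega>)) / real n - m)\<^sup>2 \<partial>M) \<le> real L * V / real n"
proof -
  interpret prob_space M by (rule M)
  define D where "D i \<omega> = Y (Z i \<omega>) - m" for i \<omega>
  have Dm [measurable]: "D i \<in> borel_measurable M" if "i \<in> {1..n}" for i
    using measurable_compose[OF Z[OF that] Y] by (simp add: D_def[abs_def])
  have D1: "integrable M (D i)" "expectation (D i) = 0" if "i \<in> {1..n}" for i
    using i1[OF that] m[OF that] by (simp_all add: D_def[abs_def] prob_space)
  have D2: "integrable M (\<lambda>\<omega>. (D i \<omega>)\<^sup>2)" if "i \<in> {1..n}" for i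
    using i1[OF that] i2[OF that] by (simp add: D_def power2_diff)
  \<comment> \<open>Centring can only lower a second moment, so \<open>V\<close> bounds the
    variances as well.\<close>
  have DV: "expectation (\<lambda>\<omega>. (D i \<omega>)\<^sup>2) \<le> V" if "i \<in> {1..n}" for i
    using variance_eq[OF i1[OF that] i2[OF that]] V[OF that] m[OF that]
    by (simp add: D_def) (smt (verit) zero_le_power2)
  have V0: "0 \<le> V" using DV[of 1] n by (smt (verit) Bochner_Integration.integral_nonneg zero_le_power2 atLeastAtMost_iff order_refl)
  have amgm: "\<bar>x * y\<bar> \<le> (x\<^sup>2 + y\<^sup>2) / 2" for x y :: real
    using sum_squares_bound[of "\<bar>x\<bar>" "\<bar>y\<bar>"] by (simp add: abs_mult)
  have DD: "integrable M (\<lambda>\<omega>. D i \<omega> * D k \<omega>)" if "i \<in> {1..n}" "k \<in> {1..n}" for i k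
  proof (rule Bochner_Integration.integrable_bound)
    show "integrable M (\<lambda>\<omega>. ((D i \<omega>)\<^sup>2 + (D k \<omega>)\<^sup>2) / 2)" using D2 that by auto
    show "AE \<omega> in M. norm (D i \<omega> * D k \<omega>) \<le> norm (((D i \<omega>)\<^sup>2 + (D k \<omega>)\<^sup>2) / 2)"
      using amgm by (auto simp: abs_of_nonneg)
  qed (use that in measurable)
  \<comment> \<open>Within an article the dependence is arbitrary, so there the covariance is
    bounded through the variances.\<close>
  have cov: "expectation (\<lambda>\<omega>. D i \<omega> * D k \<omega>) \<le> (if art k = art i then V else 0)"
    if ik: "i \<in> {1..n}" "k \<in> {1..n}" for i k
  proof (cases "art k = art i")
    case True
    have "expectation (\<lambda>\<omega>. D i \<omega> * D k \<omega>) \<le> expectation (\<lambda>\<omega>. ((D i \<omega>)\<^sup>2 + (D k \<omega>)\<^sup>2) / 2)"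
      using D2 ik by (intro integral_mono DD order_trans[OF abs_ge_self amgm]) auto
    also have "\<dots> = (expectation (\<lambda>\<omega>. (D i \<omega>)\<^sup>2) + expectation (\<lambda>\<omega>. (D k \<omega>)\<^sup>2)) / 2"
      using D2 ik by simp
    also have "\<dots> \<le> V" using DV[OF ik(1)] DV[OF ik(2)] by simp
    finally show ?thesis using True by simp
  next
    case False
    have "indep_var borel (D i) borel (D k)"
      unfolding D_def using False
      by (intro indep_across_articles_indep_var[OF M ind ik, of "\<lambda>t. Y t - m" "\<lambda>t. Y t - m"]) auto
    from indep_var_lebesgue_integral[OF this D1(1)[OF ik(1)] D1(1)[OF ik(2)]] D1(2) ik False
    show ?thesis by simp
  qed
  have sq: "((\<Sum>i=1..n. Y (Z i \<omega>)) / real n - m)\<^sup>2 = (\<Sum>i=1..n. \<Sum>k=1..n. D i \<omega> * D k \<omega>) / (real n)\<^sup>2" for \<omega>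
  proof -
    have "(\<Sum>i=1..n. Y (Z i \<omega>)) / real n - m = (\<Sum>i=1..n. D i \<omega>) / real n"
      using n by (simp add: D_def sum_subtractf field_simps)
    then show ?thesis by (simp add: power_divide power2_eq_square sum_product)
  qed
  show "integrable M (\<lambda>\<omega>. ((\<Sum>i=1..n. Y (Z i \<omega>)) / real n - m)\<^sup>2)"
    unfolding sq by (intro integrable_divide Bochner_Integration.integrable_sum DD)
  have "(\<integral>\<omega>. ((\<Sum>i=1..n. Y (Z i \<omega>)) / real n - m)\<^sup>2 \<partial>M)
      = (\<Sum>i=1..n. \<Sum>k=1..n. expectation (\<lambda>\<omega>. D i \<omega> * D k \<omega>)) / (real n)\<^sup>2"
  proof -
    have "expectation (\<lambda>\<omega>. \<Sum>i=1..n. \<Sum>k=1..n. D i \<omega> * D k \<omega>)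
        = (\<Sum>i=1..n. expectation (\<lambda>\<omega>. \<Sum>k=1..n. D i \<omega> * D k \<omega>))"
      by (intro Bochner_Integration.integral_sum Bochner_Integration.integrable_sum DD)
    also have "\<dots> = (\<Sum>i=1..n. \<Sum>k=1..n. expectation (\<lambda>\<omega>. D i \<omega> * D k \<omega>))"
      by (intro sum.cong refl Bochner_Integration.integral_sum DD)
    finally show ?thesis unfolding sq integral_divide_zero by simp
  qed
  also have "\<dots> \<le> (\<Sum>i=1..n. \<Sum>k=1..n. if art k = art i then V else 0) / (real n)\<^sup>2"
    by (intro divide_right_mono sum_mono cov) auto
  also have "\<dots> = (\<Sum>i=1..n. real (card (article_obs n art (art i))) * V) / (real n)\<^sup>2"
  proof -
    have "(\<Sum>k=1..n. if art k = art i then V else 0) = (\<Sum>k\<in>article_obs n art (art i). V)" for i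
      unfolding article_obs_def by (rule sum.inter_filter[symmetric]) simp
    then show ?thesis by (simp only: sum_constant)
  qed
  also have "\<dots> \<le> (\<Sum>i=1..n. real L * V) / (real n)\<^sup>2"
    using L V0 by (intro divide_right_mono sum_mono mult_right_mono) auto
  also have "\<dots> = real L * V / real n" using n by (simp add: power2_eq_square)
  finally show "(\<integral>\<omega>. ((\<Sum>i=1..n. Y (Z i \<omega>)) / real n - m)\<^sup>2 \<partial>M) \<le> real L * V / real n" .
qed

section \<open>The truncation level and geometrically weighted null sequences\<close>

text \<open>The weights \<open>r ^ j / r ^ J\<close> have bounded sum and concentrate on the last
  indices, where \<alpha> is small; any fixed initial segment is killed by \<open>r ^ J\<close>. For
  a merely bounded \<alpha> the quotient would only stay bounded.\<close>

lemma geometric_weighted_null_sum: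
  fixes \<alpha> :: "nat \<Rightarrow> real"
  assumes \<alpha>: "\<alpha> \<longlonglongrightarrow> 0" and r: "1 < r"
  shows "(\<lambda>J. (\<Sum>j\<le>J. \<bar>\<alpha> j\<bar> * r ^ j) / r ^ J) \<longlonglongrightarrow> 0"
proof (rule tendstoI)
  fix \<epsilon> :: real assume \<epsilon>: "0 < \<epsilon>"
  \<comment> \<open>The powers up to \<open>J\<close> add up to less than
    \<open>r ^ J * (r / (r - 1))\<close>; the second factor of \<open>e\<close> compensates
    \<open>r / (r - 1)\<close>.\<close>
  define e where "e = \<epsilon> / 2 * ((r - 1) / r)"
  have e: "0 < e" using \<epsilon> r by (simp add: e_def)
  obtain N where N: "\<And>j. N \<le> j \<Longrightarrow> \<bar>\<alpha> j\<bar> < e"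
    using LIMSEQ_D[OF \<alpha> e] by auto
  define K where "K = (\<Sum>j<N. \<bar>\<alpha> j\<bar> * r ^ j)"
  have bound: "(\<Sum>j\<le>J. \<bar>\<alpha> j\<bar> * r ^ j) / r ^ J \<le> K / r ^ J + \<epsilon> / 2" for J
  proof -
    have "(\<Sum>j\<le>J. \<bar>\<alpha> j\<bar> * r ^ j) \<le> (\<Sum>j\<le>J. (if j < N then \<bar>\<alpha> j\<bar> * r ^ j else 0) + e * r ^ j)"
      using N r e by (intro sum_mono) (auto intro!: mult_right_mono less_imp_le simp: not_less)
    also have "\<dots> = (\<Sum>j\<in>{..J} \<inter> {..<N}. \<bar>\<alpha> j\<bar> * r ^ j) + e * (\<Sum>j\<le>J. r ^ j)"
      by (simp add: sum.distrib sum.If_cases sum_distrib_left lessThan_def)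
    also have "\<dots> \<le> K + e * (\<Sum>j\<le>J. r ^ j)"
      unfolding K_def using r by (intro add_right_mono sum_mono2) auto
    also have "(\<Sum>j\<le>J. r ^ j) = (r ^ Suc J - 1) / (r - 1)"
      using r geometric_sum[of r "Suc J"] by (simp only: lessThan_Suc_atMost)
    also have "K + e * ((r ^ Suc J - 1) / (r - 1)) \<le> K + e * (r ^ Suc J / (r - 1))"
      using r e by (intro add_left_mono mult_left_mono divide_right_mono) auto
    also have "e * (r ^ Suc J / (r - 1)) = \<epsilon> / 2 * r ^ J" using r by (simp add: e_def field_simps)
    finally show ?thesis using r by (simp add: pos_divide_le_eq field_simps)
  qed
  have "(\<lambda>J. K / r ^ J) \<longlonglongrightarrow> 0"
    using tendsto_mult_right_zero[OF LIMSEQ_inverse_realpow_zero[OF r], of K] by (simp add: divide_inverse)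
  then have "eventually (\<lambda>J. K / r ^ J < \<epsilon> / 2) sequentially"
    using \<epsilon> by (intro order_tendstoD(2)[of _ 0]) auto
  then show "eventually (\<lambda>J. dist ((\<Sum>j\<le>J. \<bar>\<alpha> j\<bar> * r ^ j) / r ^ J) 0 < \<epsilon>) sequentially"
  proof eventually_elim
    case (elim J)
    have "0 \<le> (\<Sum>j\<le>J. \<bar>\<alpha> j\<bar> * r ^ j) / r ^ J" using r by (intro divide_nonneg_pos sum_nonneg) auto
    then show ?case using bound[of J] elim unfolding dist_real_def by linarith
  qed
qed

lemma trunc_J_at_top:
  assumes A: "0 < A"
  shows "filterlim (trunc_J A) at_top sequentially"
proof -
  have "filterlim (\<lambda>n. 2 / (3 * ln 2) * ln (A * real n)) at_top sequentially"
    by (rule filterlim_tendsto_pos_mult_at_top[OF tendsto_const _ filterlim_compose[OF ln_at_top]],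
        simp, rule filterlim_tendsto_pos_mult_at_top[OF tendsto_const A filterlim_real_sequentially])
  then have "filterlim (\<lambda>n. real (trunc_J A n)) at_top sequentially"
    by (rule filterlim_at_top_mono) (auto simp: trunc_J_def intro!: always_eventually, linarith)
  then show ?thesis by (simp add: filterlim_sequentially_iff_filterlim_real)
qed

text \<open>The ceiling adds at most one to the level, hence the factor \<open>sqrt 2\<close>; the
  constant \<open>2 / (3 * ln 2)\<close> turns the rest into a cube root.
  \<open>1 \<le> A * real n\<close> makes the logarithm nonnegative, so that the conversion to
  \<open>nat\<close> changes nothing.\<close>

lemma trunc_J_power_le:
  assumes "1 \<le> A * real n" "0 < A"
  shows "sqrt 2 ^ trunc_J A n \<le> sqrt 2 * A powr (1 / 3) * real n powr (1 / 3)"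
proof -
  define x where "x = 2 / (3 * ln 2) * ln (A * real n)"
  have "n \<noteq> 0" using assms by (metis mult_zero_right not_one_le_zero of_nat_0)
  then have n: "0 < real n" by simp
  have "0 \<le> x" using assms by (simp add: x_def)
  then have J: "real (trunc_J A n) \<le> x + 1" unfolding trunc_J_def x_def[symmetric] by linarith
  have "sqrt 2 ^ trunc_J A n = 2 powr (real (trunc_J A n) / 2)"
    by (simp add: powr_half_sqrt[symmetric] powr_powr flip: powr_realpow)
  also have "\<dots> \<le> 2 powr (x / 2 + 1 / 2)" using J by simp
  also have "\<dots> = 2 powr (x / 2) * sqrt 2" by (simp only: powr_add powr_half_sqrt)
  also have "2 powr (x / 2) = (A * real n) powr (1 / 3)"
    using assms n by (simp add: powr_def x_def)
  also have "\<dots> = A powr (1 / 3) * real n powr (1 / 3)" using assms n by (simp add: powr_mult)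
  finally show ?thesis by (simp add: mult_ac)
qed

text \<open>\<open>sqrt 2 ^ trunc_J A n\<close> has at most the order of the cube root of
  \<open>n\<close>, so the null sequence \<alpha> decides. The limit serves the plug-in error
  directly and the variance after squaring.\<close>

lemma truncated_weighted_sum_tendsto_0:
  fixes \<alpha> :: "nat \<Rightarrow> real"
  assumes \<alpha>: "\<alpha> \<longlonglongrightarrow> 0" and A: "0 < A"
  shows "(\<lambda>n. (\<Sum>j\<le>trunc_J A n. \<bar>\<alpha> j\<bar> * sqrt 2 ^ j) / real n powr (1 / 3)) \<longlonglongrightarrow> 0"
proof -
  let ?S = "\<lambda>J. \<Sum>j\<le>J. \<bar>\<alpha> j\<bar> * sqrt 2 ^ j"
  let ?B = "sqrt 2 * A powr (1 / 3)"
  have "(\<lambda>n. ?B * (?S (trunc_J A n) / sqrt 2 ^ trunc_J A n)) \<longlonglongrightarrow> ?B * 0"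
    by (intro tendsto_mult_left filterlim_compose[OF geometric_weighted_null_sum[OF \<alpha>] trunc_J_at_top[OF A]]) simp
  then have lim: "(\<lambda>n. ?B * (?S (trunc_J A n) / sqrt 2 ^ trunc_J A n)) \<longlonglongrightarrow> 0" by simp
  have ev: "eventually (\<lambda>n. 1 \<le> A * real n) sequentially"
    using filterlim_tendsto_pos_mult_at_top[OF tendsto_const A filterlim_real_sequentially]
    by (simp add: filterlim_at_top)
  show ?thesis
  proof (rule tendsto_sandwich[OF _ _ tendsto_const lim])
    show "eventually (\<lambda>n. 0 \<le> ?S (trunc_J A n) / real n powr (1 / 3)) sequentially"
      by (intro always_eventually allI divide_nonneg_nonneg sum_nonneg) auto
    from ev show "eventually (\<lambda>n. ?S (trunc_J A n) / real n powr (1 / 3)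
        \<le> ?B * (?S (trunc_J A n) / sqrt 2 ^ trunc_J A n)) sequentially"
    proof eventually_elim
      case (elim n)
      have "n \<noteq> 0" using elim by (metis mult_zero_right not_one_le_zero of_nat_0)
      then have n: "0 < real n" by simp
      have "?S (trunc_J A n) * sqrt 2 ^ trunc_J A n \<le> ?S (trunc_J A n) * (?B * real n powr (1 / 3))"
        using trunc_J_power_le[OF elim A] by (intro mult_left_mono sum_nonneg) auto
      then show ?case using n by (simp add: divide_simps mult_ac)
    qed
  qed
qed

section \<open>The law of published findings\<close>

lemma std_normal_density_le_1: "std_normal_density x \<le> 1"
proof -
  have "1 \<le> sqrt (2 * pi)" using pi_ge_two by simp
  then have "1 / sqrt (2 * pi) \<le> 1" by simp
  moreover have "exp (- x\<^sup>2 / 2) \<le> 1" by simp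
  ultimately have "1 / sqrt (2 * pi) * exp (- x\<^sup>2 / 2) \<le> 1 * 1" by (intro mult_mono) auto
  then show ?thesis by (simp add: std_normal_density_def)
qed

lemma finding_model_eq:
  "finding_model \<pi> s = density (lborel \<Otimes>\<^sub>M lborel \<Otimes>\<^sub>M count_space UNIV)
     (\<lambda>(z, x, d). ennreal (\<pi> z * std_normal_density (x - z) * (if d then s x else 1 - s x)))"
  by (simp add: finding_model_def normal_density_def)

text \<open>The constant \<open>c\<close> is the probability of publication. The lower bound
  \<delta> on the selection function makes it positive, so conditioning on publication amounts to
  dividing the selected density by \<open>c\<close>.\<close>

lemma published_abs_law_eq:
  assumes [measurable]: "\<pi> \<in> borel_measurable borel" "s \<in> borel_measurable borel"
    and \<pi>0: "\<And>z. 0 \<le> \<pi> z" and \<pi>1: "(\<integral>\<^sup>+z. ennreal (\<pi> z) \<partial>lborel) = 1"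
    and s: "0 < \<delta>" "\<And>x. \<delta> \<le> s x" "\<And>x. s x \<le> 1"
  obtains c where "0 < c" "c \<le> 1"
    "published_abs_law \<pi> s = distr (density (lborel \<Otimes>\<^sub>M lborel)
        (\<lambda>(z, x). ennreal (\<pi> z * std_normal_density (x - z) * s x / c))) borel (\<lambda>(z, x). \<bar>x\<bar>)"
proof -
  define S :: "(real \<times> real \<times> bool) set" where "S = {(z, x, d). d}"
  let ?M = "finding_model \<pi> s"
  let ?k = "\<lambda>z x. \<pi> z * std_normal_density (x - z) * s x"
  have s0: "0 \<le> s x" for x using s(1) s(2)[of x] by linarith
  interpret cs: sigma_finite_measure "count_space (UNIV :: bool set)"
    by (rule sigma_finite_measure_count_space_finite) simp
  interpret lc: pair_sigma_finite lborel "count_space (UNIV :: bool set)" ..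
  have lcs: "sigma_finite_measure (lborel \<Otimes>\<^sub>M count_space (UNIV :: bool set) :: (real \<times> bool) measure)" ..
  have S [measurable]: "S \<in> sets (lborel \<Otimes>\<^sub>M lborel \<Otimes>\<^sub>M count_space UNIV)"
  proof -
    have "{w \<in> space (lborel \<Otimes>\<^sub>M lborel \<Otimes>\<^sub>M count_space UNIV :: (real \<times> real \<times> bool) measure). snd (snd w)}
        \<in> sets (lborel \<Otimes>\<^sub>M lborel \<Otimes>\<^sub>M count_space UNIV)"
      by measurable
    also have "{w \<in> space (lborel \<Otimes>\<^sub>M lborel \<Otimes>\<^sub>M count_space UNIV :: (real \<times> real \<times> bool) measure). snd (snd w)} = S"
      by (auto simp: S_def space_pair_measure)
    finally show ?thesis .
  qed
  have SM: "S \<in> sets (finding_model \<pi> s)" using S unfolding finding_model_def sets_density .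
  have dens [measurable]: "(\<lambda>(z, x, d). ennreal (\<pi> z * std_normal_density (x - z) * (if d then s x else 1 - s x)))
      \<in> borel_measurable (lborel \<Otimes>\<^sub>M lborel \<Otimes>\<^sub>M count_space (UNIV :: bool set))"
    by measurable
  have nn: "(\<integral>\<^sup>+w. F (fst (snd w)) * indicator S w \<partial>?M) = (\<integral>\<^sup>+z. \<integral>\<^sup>+x. ennreal (?k z x) * F x \<partial>lborel \<partial>lborel)"
    if F [measurable]: "F \<in> borel_measurable borel" for F :: "real \<Rightarrow> ennreal"
  proof -
    have "(\<integral>\<^sup>+w. F (fst (snd w)) * indicator S w \<partial>?M)
      = (\<integral>\<^sup>+w. (case w of (z, x, d) \<Rightarrow> ennreal (\<pi> z * std_normal_density (x - z) * (if d then s x else 1 - s x)))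
            * (F (fst (snd w)) * indicator S w) \<partial>(lborel \<Otimes>\<^sub>M lborel \<Otimes>\<^sub>M count_space UNIV))"
      unfolding finding_model_eq
      by (subst nn_integral_density) (auto intro!: borel_measurable_times_ennreal)
    also have "\<dots> = (\<integral>\<^sup>+w. (if snd (snd w) then ennreal (?k (fst w) (fst (snd w))) * F (fst (snd w)) else 0)
        \<partial>(lborel \<Otimes>\<^sub>M lborel \<Otimes>\<^sub>M count_space UNIV))"
      by (intro nn_integral_cong) (auto simp: S_def split: split_indicator)
    also have "\<dots> = (\<integral>\<^sup>+z. \<integral>\<^sup>+y. (if snd y then ennreal (?k z (fst y)) * F (fst y) else 0)
        \<partial>(lborel \<Otimes>\<^sub>M count_space UNIV) \<partial>lborel)"
      by (subst sigma_finite_measure.nn_integral_fst[OF lcs, symmetric]) (measurable, simp only: fst_conv snd_conv)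
    also have "\<dots> = (\<integral>\<^sup>+z. \<integral>\<^sup>+x. \<integral>\<^sup>+d. (if d then ennreal (?k z x) * F x else 0) \<partial>count_space UNIV \<partial>lborel \<partial>lborel)"
      by (intro nn_integral_cong, subst cs.nn_integral_fst[symmetric]) (measurable, simp only: fst_conv snd_conv)
    also have "\<dots> = (\<integral>\<^sup>+z. \<integral>\<^sup>+x. ennreal (?k z x) * F x \<partial>lborel \<partial>lborel)"
      by (simp add: nn_integral_count_space_finite UNIV_bool)
    finally show ?thesis .
  qed
  define K where "K = emeasure ?M S"
  have K: "K = (\<integral>\<^sup>+z. \<integral>\<^sup>+x. ennreal (?k z x) \<partial>lborel \<partial>lborel)"
    unfolding K_def
  proof -
    show "emeasure ?M S = (\<integral>\<^sup>+z. \<integral>\<^sup>+x. ennreal (?k z x) \<partial>lborel \<partial>lborel)"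
      using nn[of "\<lambda>_. 1"] SM by simp
  qed
  have phi1: "(\<integral>\<^sup>+x. ennreal (std_normal_density (x - z)) \<partial>lborel) = 1" for z
    using prob_space.emeasure_space_1[OF prob_space_normal_density[of 1 z]]
    by (simp add: emeasure_density normal_density_def)
  \<comment> \<open>Used with \<open>a = 1\<close> for the upper and with
    \<open>a = \<delta>\<close> for the lower bound on \<open>K\<close>.\<close>
  have tot: "(\<integral>\<^sup>+z. \<integral>\<^sup>+x. ennreal (a * (\<pi> z * std_normal_density (x - z))) \<partial>lborel \<partial>lborel) = ennreal a"
    if "0 \<le> a" for a
    using that \<pi>0 by (simp add: ennreal_mult' nn_integral_cmult phi1 \<pi>1)
  have "K \<le> (\<integral>\<^sup>+z. \<integral>\<^sup>+x. ennreal (1 * (\<pi> z * std_normal_density (x - z))) \<partial>lborel \<partial>lborel)"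
    unfolding K using s \<pi>0 s0
    by (intro nn_integral_mono ennreal_leI) (auto intro!: mult_left_le)
  then have K1: "K \<le> 1" by (subst (asm) tot) auto
  have "(\<integral>\<^sup>+z. \<integral>\<^sup>+x. ennreal (\<delta> * (\<pi> z * std_normal_density (x - z))) \<partial>lborel \<partial>lborel) \<le> K"
    unfolding K using s \<pi>0 s0
    by (intro nn_integral_mono ennreal_leI) (auto intro!: mult_left_mono simp: mult.commute[of \<delta>])
  then have K0: "ennreal \<delta> \<le> K" by (subst (asm) tot) (use s in auto)
  define c where "c = enn2real K"
  have Kc: "K = ennreal c" unfolding c_def using K1 by (metis ennreal_enn2real_if ennreal_one_neq_top top.extremum_unique)
  have c: "0 < c" "c \<le> 1"
    using K0 K1 s(1) unfolding Kc by (auto simp: ennreal_le_iff2)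
  have K': "K \<noteq> 0" using c Kc by simp
  show thesis
  proof (rule that[OF c])
    show "published_abs_law \<pi> s = distr (density (lborel \<Otimes>\<^sub>M lborel)
        (\<lambda>(z, x). ennreal (?k z x / c))) borel (\<lambda>(z, x). \<bar>x\<bar>)" (is "_ = ?R")
    proof (rule measure_eqI)
      fix A assume "A \<in> sets (published_abs_law \<pi> s)"
      then have A [measurable]: "A \<in> sets borel" by (simp add: published_abs_law_def)
      have sM: "sets ?M = sets (lborel \<Otimes>\<^sub>M lborel \<Otimes>\<^sub>M count_space UNIV)"
        by (simp add: finding_model_def)
      have abs: "(\<lambda>(z, x, d). \<bar>x\<bar>) \<in> borel_measurable (uniform_measure ?M S)"
        using sM by (subst measurable_cong_sets[OF _ refl, of _ "lborel \<Otimes>\<^sub>M lborel \<Otimes>\<^sub>M count_space UNIV"]) auto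
      have m2: "(\<lambda>w. indicator A ((\<lambda>(z, x, d). \<bar>x\<bar>) w) :: ennreal) \<in> borel_measurable ?M"
        by (subst measurable_cong_sets[OF sM refl]) measurable
      have "emeasure (published_abs_law \<pi> s) A = (\<integral>\<^sup>+w. indicator A ((\<lambda>(z, x, d). \<bar>x\<bar>) w) \<partial>uniform_measure ?M S)"
        unfolding published_abs_law_def S_def[symmetric]
        by (subst nn_integral_distr[OF abs, symmetric]) auto
      also have "\<dots> = (\<integral>\<^sup>+w. indicator A \<bar>fst (snd w)\<bar> * indicator S w \<partial>?M) / K"
        unfolding K_def
        by (subst nn_integral_uniform_measure[OF m2 SM])
           (auto intro!: arg_cong2[where f="(/)"] nn_integral_cong)
      also have "\<dots> = (\<integral>\<^sup>+z. \<integral>\<^sup>+x. ennreal (?k z x) * indicator A \<bar>x\<bar> \<partial>lborel \<partial>lborel) / K"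
        by (subst nn) auto
      also have "\<dots> = (\<integral>\<^sup>+z. \<integral>\<^sup>+x. ennreal (?k z x / c) * indicator A \<bar>x\<bar> \<partial>lborel \<partial>lborel)"
        using c \<pi>0 s0
        by (simp add: Kc divide_ennreal_def nn_integral_cmult[symmetric] inverse_ennreal ennreal_mult'' divide_inverse mult_ac
              flip: nn_integral_multc)
      also have "\<dots> = (\<integral>\<^sup>+w. ennreal (?k (fst w) (snd w) / c) * indicator A \<bar>snd w\<bar> \<partial>(lborel \<Otimes>\<^sub>M lborel))"
        by (subst lborel.nn_integral_fst[symmetric]) auto
      also have "\<dots> = (\<integral>\<^sup>+w. indicator A w \<partial>?R)"
        unfolding split_beta'
        by (subst nn_integral_distr, measurable, subst nn_integral_density, measurable)
      also have "\<dots> = emeasure ?R A" by simp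
      finally show "emeasure (published_abs_law \<pi> s) A = emeasure ?R A" .
    qed (simp add: published_abs_law_def)
  qed
qed

section \<open>Hermite kernels: convolution with the normal density and moments\<close>

text \<open>The numerators of \<open>coeff_b_hat\<close> without absolute values. The reflected
  second term makes the kernel even in \<open>t\<close>, so it depends on an observation only
  through the absolute value, whose law is the one assumed.\<close>

definition hermite_kernel :: "real \<Rightarrow> nat \<Rightarrow> real \<Rightarrow> real" where
  "hermite_kernel x0 j t = hermite_psi j (x0 - t) * std_normal_density (x0 - t)
    + hermite_psi j (x0 + t) * std_normal_density (x0 + t)"

lemma hermite_kernel_measurable [measurable]: "hermite_kernel x0 j \<in> borel_measurable borel"
  unfolding hermite_kernel_def[abs_def] by measurable

lemma hermite_kernel_abs [simp]: "hermite_kernel x0 j \<bar>t\<bar> = hermite_kernel x0 j t"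
  by (simp add: hermite_kernel_def abs_if)

text \<open>Completing the square: the substitution \<open>w = y / 2 + v / sqrt 2\<close> splits the
  product of the two densities into a factor in \<open>y\<close> and the standard normal density in
  \<open>v\<close>. What is left is the expectation evaluated by
  \<open>gauss_hermite_mehler\<close>.\<close>

lemma hermite_psi_density_convolution:
  "(\<integral>w. std_normal_density (y - w) * (hermite_psi j w * std_normal_density w) \<partial>lborel)
    = 2 powr (- real j / 2) * (hermite_psi j (y / sqrt 2) * std_normal_density (y / sqrt 2)) / sqrt 2"
proof -
  have dens: "std_normal_density (y - (y / 2 + 1 / sqrt 2 * v)) * std_normal_density (y / 2 + 1 / sqrt 2 * v)
      = std_normal_density (y / sqrt 2) * std_normal_density v" for v
  proof -
    have "(y - (y / 2 + 1 / sqrt 2 * v))\<^sup>2 + (y / 2 + 1 / sqrt 2 * v)\<^sup>2 = (y / sqrt 2)\<^sup>2 + v\<^sup>2"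
      by (simp add: power2_eq_square field_simps)
    then have "- (y - (y / 2 + 1 / sqrt 2 * v))\<^sup>2 / 2 + - (y / 2 + 1 / sqrt 2 * v)\<^sup>2 / 2
        = - (y / sqrt 2)\<^sup>2 / 2 + - v\<^sup>2 / 2" by linarith
    then have "exp (- (y - (y / 2 + 1 / sqrt 2 * v))\<^sup>2 / 2) * exp (- (y / 2 + 1 / sqrt 2 * v)\<^sup>2 / 2)
        = exp (- (y / sqrt 2)\<^sup>2 / 2) * exp (- v\<^sup>2 / 2)"
      by (simp only: exp_add[symmetric])
    from arg_cong[OF this, of "(*) (1 / sqrt (2 * pi) * (1 / sqrt (2 * pi)))"] show ?thesis
      unfolding std_normal_density_def by (simp only: mult_ac)
  qed
  have "(\<integral>w. std_normal_density (y - w) * (hermite_psi j w * std_normal_density w) \<partial>lborel)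
    = (1 / sqrt 2) * (\<integral>v. std_normal_density (y - (y / 2 + 1 / sqrt 2 * v)) *
        (hermite_psi j (y / 2 + 1 / sqrt 2 * v) * std_normal_density (y / 2 + 1 / sqrt 2 * v)) \<partial>lborel)"
    by (subst lborel_integral_real_affine[where t = "y / 2" and c = "1 / sqrt 2"]) auto
  also have "(\<lambda>v. std_normal_density (y - (y / 2 + 1 / sqrt 2 * v)) *
        (hermite_psi j (y / 2 + 1 / sqrt 2 * v) * std_normal_density (y / 2 + 1 / sqrt 2 * v)))
    = (\<lambda>v. (std_normal_density (y / sqrt 2) / sqrt (fact j)) *
        (std_normal_density v * poly (pcompose (hermite_poly j) [:y / 2, 1 / sqrt 2:]) v))"
  proof
    fix v
    have "std_normal_density (y - (y / 2 + 1 / sqrt 2 * v)) *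
        (hermite_psi j (y / 2 + 1 / sqrt 2 * v) * std_normal_density (y / 2 + 1 / sqrt 2 * v))
      = (std_normal_density (y - (y / 2 + 1 / sqrt 2 * v)) * std_normal_density (y / 2 + 1 / sqrt 2 * v))
        * hermite_psi j (y / 2 + 1 / sqrt 2 * v)" by (simp only: mult_ac)
    then show "std_normal_density (y - (y / 2 + 1 / sqrt 2 * v)) *
        (hermite_psi j (y / 2 + 1 / sqrt 2 * v) * std_normal_density (y / 2 + 1 / sqrt 2 * v))
      = (std_normal_density (y / sqrt 2) / sqrt (fact j)) *
        (std_normal_density v * poly (pcompose (hermite_poly j) [:y / 2, 1 / sqrt 2:]) v)"
      unfolding dens by (simp add: hermite_psi_def poly_pcompose poly_hermite_poly mult.commute)
  qed
  also have "(\<integral>v. (std_normal_density (y / sqrt 2) / sqrt (fact j)) *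
        (std_normal_density v * poly (pcompose (hermite_poly j) [:y / 2, 1 / sqrt 2:]) v) \<partial>lborel)
      = (std_normal_density (y / sqrt 2) / sqrt (fact j)) * gauss (pcompose (hermite_poly j) [:y / 2, 1 / sqrt 2:])"
    by (simp add: gauss_def integral_std_normal_distribution)
  finally show ?thesis
    unfolding gauss_hermite_mehler by (simp add: hermite_psi_def mult_ac)
qed

lemma hermite_psi_density_integrable:
  "integrable lborel (\<lambda>w. hermite_psi j w * std_normal_density w)"
  using std_normal_integrable_poly[of "hermite_psi_poly j"]
  by (subst (asm) integrable_std_normal_distribution_iff) (auto simp: hermite_psi_eq_poly mult.commute)

lemma lborel_integrable_affine:
  fixes f :: "real \<Rightarrow> real"
  shows "integrable lborel f \<Longrightarrow> c \<noteq> 0 \<Longrightarrow> integrable lborel (\<lambda>x. f (t + c * x))"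
  by (simp add: lborel_integrable_real_affine)

text \<open>This is the conditional mean of the kernel given the effect \<open>z\<close>. The
  argument divided by \<open>sqrt 2\<close> is where the variable of the Hermite expansion comes
  from.\<close>

lemma hermite_kernel_convolution:
  "(\<integral>x. std_normal_density (x - z) * hermite_kernel x0 j x \<partial>lborel)
    = 2 powr (- real j / 2) / sqrt 2 *
      (hermite_psi j ((x0 - z) / sqrt 2) * std_normal_density ((x0 - z) / sqrt 2)
       + hermite_psi j ((x0 + z) / sqrt 2) * std_normal_density ((x0 + z) / sqrt 2))"
proof -
  let ?g = "\<lambda>w. hermite_psi j w * std_normal_density w"
  have sym: "std_normal_density (- x) = std_normal_density x" for x
    by (simp add: std_normal_density_def)
  have bnd: "integrable lborel (\<lambda>x. std_normal_density (x - z) * h x)" if "integrable lborel h" for h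
    by (rule Bochner_Integration.integrable_bound[OF that])
       (use that in \<open>auto simp: abs_mult std_normal_density_le_1 intro!: mult_left_le_one_le\<close>)
  have i1: "integrable lborel (\<lambda>x. std_normal_density (x - z) * ?g (x0 - x))"
    using lborel_integrable_affine[OF hermite_psi_density_integrable[of j], where c = "-1" and t = x0] by (intro bnd) auto
  have i2: "integrable lborel (\<lambda>x. std_normal_density (x - z) * ?g (x0 + x))"
    using lborel_integrable_affine[OF hermite_psi_density_integrable[of j], where c = 1 and t = x0] by (intro bnd) auto
  have "(\<integral>x. std_normal_density (x - z) * ?g (x0 - x) \<partial>lborel)
      = (\<integral>w. std_normal_density ((x0 - z) - w) * ?g w \<partial>lborel)"
    by (subst lborel_integral_real_affine[where t = x0 and c = "-1"]) (auto simp: algebra_simps)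
  moreover have "(\<integral>x. std_normal_density (x - z) * ?g (x0 + x) \<partial>lborel)
      = (\<integral>w. std_normal_density ((x0 + z) - w) * ?g w \<partial>lborel)"
  proof (subst lborel_integral_real_affine[where t = "- x0" and c = 1])
    have "std_normal_density (- x0 + 1 * x - z) = std_normal_density (x0 + z - x)" for x
      using sym[of "x0 + z - x"] by (simp add: algebra_simps)
    then show "\<bar>1\<bar> *\<^sub>R (\<integral>x. std_normal_density (- x0 + 1 * x - z) * ?g (x0 + (- x0 + 1 * x)) \<partial>lborel)
      = (\<integral>w. std_normal_density ((x0 + z) - w) * ?g w \<partial>lborel)" by simp
  qed simp
  ultimately show ?thesis
    using i1 i2 by (simp add: hermite_kernel_def distrib_left hermite_psi_density_convolution)
qed

lemma nn_integral_std_normal_density_shift: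
  "(\<integral>\<^sup>+z. ennreal (std_normal_density (x - z)) \<partial>lborel) = 1"
proof -
  have "std_normal_density (x - z) = normal_density x 1 z" for z
    by (simp add: normal_density_def power2_commute)
  then show ?thesis
    using prob_space.emeasure_space_1[OF prob_space_normal_density[of 1 x]]
    by (simp add: emeasure_density)
qed

text \<open>Here \<open>z\<close> runs over Lebesgue measure. The moment bounds first replace
  \<open>\<pi> z\<close> by its upper bound; the normal density then integrates to 1 over
  \<open>z\<close>.\<close>

lemma std_normal_convolution_integrable:
  fixes h :: "real \<Rightarrow> real"
  assumes h: "integrable lborel h"
  shows "integrable (lborel \<Otimes>\<^sub>M lborel) (\<lambda>(z, x). std_normal_density (x - z) * h x)"
    and "(\<integral>w. (case w of (z, x) \<Rightarrow> std_normal_density (x - z) * h x) \<partial>(lborel \<Otimes>\<^sub>M lborel)) = (\<integral>x. h x \<partial>lborel)"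
proof -
  have [measurable]: "h \<in> borel_measurable borel" using h by auto
  show int: "integrable (lborel \<Otimes>\<^sub>M lborel) (\<lambda>(z, x). std_normal_density (x - z) * h x)"
  proof (rule integrableI_bounded)
    have "(\<integral>\<^sup>+w. ennreal (norm (case w of (z, x) \<Rightarrow> std_normal_density (x - z) * h x)) \<partial>(lborel \<Otimes>\<^sub>M lborel))
        = (\<integral>\<^sup>+w. (case w of (z, x) \<Rightarrow> ennreal \<bar>h x\<bar> * ennreal (std_normal_density (x - z))) \<partial>(lborel \<Otimes>\<^sub>M lborel))"
      by (intro nn_integral_cong) (auto simp: abs_mult ennreal_mult mult.commute)
    also have "\<dots> = (\<integral>\<^sup>+x. \<integral>\<^sup>+z. ennreal \<bar>h x\<bar> * ennreal (std_normal_density (x - z)) \<partial>lborel \<partial>lborel)"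
      by (subst lborel_pair.nn_integral_snd[symmetric]) auto
    also have "\<dots> = (\<integral>\<^sup>+x. ennreal \<bar>h x\<bar> \<partial>lborel)"
      by (simp add: nn_integral_cmult nn_integral_std_normal_density_shift)
    also have "\<dots> < \<infinity>" using h by (simp add: integrable_iff_bounded)
    finally show "(\<integral>\<^sup>+w. ennreal (norm (case w of (z, x) \<Rightarrow> std_normal_density (x - z) * h x)) \<partial>(lborel \<Otimes>\<^sub>M lborel)) < \<infinity>" .
  qed measurable
  have "(\<integral>z. std_normal_density (x - z) \<partial>lborel) = 1" for x
    using nn_integral_std_normal_density_shift[of x] by (subst integral_eq_nn_integral) auto
  then show "(\<integral>w. (case w of (z, x) \<Rightarrow> std_normal_density (x - z) * h x) \<partial>(lborel \<Otimes>\<^sub>M lborel)) = (\<integral>x. h x \<partial>lborel)"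
    by (subst lborel_pair.integral_snd[OF int, symmetric]) simp
qed

text \<open>The bound has to be uniform in \<open>j\<close>. Of the two density factors in a square,
  one is at most 1 and the other makes orthonormality applicable, so each reflected term contributes
  at most 1; the inequality \<open>(a + b)\<^sup>2 \<le> 2 * a\<^sup>2 + 2 * b\<^sup>2\<close> then
  gives 4.\<close>

lemma hermite_kernel_square_integral:
  "integrable lborel (\<lambda>t. (hermite_kernel x0 j t)\<^sup>2)" "(\<integral>t. (hermite_kernel x0 j t)\<^sup>2 \<partial>lborel) \<le> 4"
proof -
  let ?q = "\<lambda>w. std_normal_density w * (hermite_psi j w * hermite_psi j w)"
  have iq: "integrable lborel ?q"
    using std_normal_integrable_poly[of "hermite_psi_poly j * hermite_psi_poly j"]
    by (subst (asm) integrable_std_normal_distribution_iff) (auto simp: hermite_psi_eq_poly)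
  have q1: "(\<integral>w. ?q w \<partial>lborel) = 1"
    using hermite_psi_orthonormal[of j j] by (simp add: integral_std_normal_distribution)
  have im: "integrable lborel (\<lambda>t. ?q (x0 - t))"
    using lborel_integrable_affine[OF iq, where c = "-1" and t = x0] by simp
  have ip: "integrable lborel (\<lambda>t. ?q (x0 + t))"
    using lborel_integrable_affine[OF iq, where c = 1 and t = x0] by simp
  have qm: "(\<integral>t. ?q (x0 - t) \<partial>lborel) = 1"
    using lborel_integral_real_affine[of "-1" ?q x0] q1 by simp
  have qp: "(\<integral>t. ?q (x0 + t) \<partial>lborel) = 1"
    using lborel_integral_real_affine[of 1 ?q x0] q1 by simp
  have sq: "(hermite_psi j w * std_normal_density w)\<^sup>2 \<le> ?q w" for w
  proof -
    have "(hermite_psi j w * hermite_psi j w) * std_normal_density w * std_normal_density w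
        \<le> (hermite_psi j w * hermite_psi j w) * std_normal_density w * 1"
      by (intro mult_left_mono std_normal_density_le_1) auto
    then show ?thesis by (simp add: power2_eq_square mult_ac)
  qed
  have le: "(hermite_kernel x0 j t)\<^sup>2 \<le> 2 * ?q (x0 - t) + 2 * ?q (x0 + t)" for t
  proof -
    have "(a + b)\<^sup>2 \<le> 2 * a\<^sup>2 + 2 * b\<^sup>2" for a b :: real
      using sum_squares_bound[of a b] by (simp add: power2_sum)
    then show ?thesis
      unfolding hermite_kernel_def
      by (rule order_trans) (intro add_mono mult_left_mono sq; simp)
  qed
  have ib: "integrable lborel (\<lambda>t. 2 * ?q (x0 - t) + 2 * ?q (x0 + t))"
    by (intro Bochner_Integration.integrable_add integrable_mult_right im ip)
  show ik: "integrable lborel (\<lambda>t. (hermite_kernel x0 j t)\<^sup>2)"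
    by (rule Bochner_Integration.integrable_bound[OF ib]) (auto intro!: AE_I2 order_trans[OF le] abs_ge_self)
  have "(\<integral>t. (hermite_kernel x0 j t)\<^sup>2 \<partial>lborel) \<le> (\<integral>t. 2 * ?q (x0 - t) + 2 * ?q (x0 + t) \<partial>lborel)"
    by (intro integral_mono ik ib le)
  also have "\<dots> = 2 * (\<integral>t. ?q (x0 - t) \<partial>lborel) + 2 * (\<integral>t. ?q (x0 + t) \<partial>lborel)"
    by (simp only: Bochner_Integration.integral_add[OF integrable_mult_right[OF im] integrable_mult_right[OF ip]]
        integral_mult_right_zero)
  finally show "(\<integral>t. (hermite_kernel x0 j t)\<^sup>2 \<partial>lborel) \<le> 4" unfolding qm qp by simp
qed

lemma hermite_kernel_integrable: "integrable lborel (hermite_kernel x0 j)"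
  using lborel_integrable_affine[OF hermite_psi_density_integrable[of j], where c = "-1" and t = x0]
    lborel_integrable_affine[OF hermite_psi_density_integrable[of j], where c = 1 and t = x0]
  unfolding hermite_kernel_def[abs_def] by (intro Bochner_Integration.integrable_add) auto

lemma integrable_bounded_mult:
  fixes f g :: "real \<Rightarrow> real"
  assumes [measurable]: "f \<in> borel_measurable borel" and "\<And>x. \<bar>f x\<bar> \<le> B" and g: "integrable lborel g"
  shows "integrable lborel (\<lambda>x. f x * g x)"
proof (rule Bochner_Integration.integrable_bound[OF integrable_mult_right[OF g, of B]])
  have "g \<in> borel_measurable borel" using g by auto
  then show "(\<lambda>x. f x * g x) \<in> borel_measurable lborel" by simp
  have "\<bar>f x\<bar> * \<bar>g x\<bar> \<le> \<bar>B\<bar> * \<bar>g x\<bar>" for x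
    using assms(2)[of x] by (intro mult_right_mono) auto
  then show "AE x in lborel. norm (f x * g x) \<le> norm (B * g x)" by (auto simp: abs_mult)
qed

text \<open>Reflecting \<open>z\<close> in the second kernel term moves the sign into
  \<open>\<pi>\<close>, and the two terms add up to twice \<open>symmetrized \<pi>\<close>. The
  Jacobian \<open>sqrt 2\<close> of the passage to \<open>u\<close> cancels the
  \<open>1 / sqrt 2\<close> of the convolution.\<close>

lemma symmetrized_kernel_integral:
  assumes [measurable]: "\<pi> \<in> borel_measurable borel" and \<pi>0: "\<And>z. 0 \<le> \<pi> z" and B: "\<And>z. \<pi> z \<le> B"
  shows "(\<integral>z. \<pi> z * (\<integral>x. std_normal_density (x - z) * hermite_kernel x0 j x \<partial>lborel) \<partial>lborel)
    = 2 * 2 powr (- real j / 2) * hermite_coeff (\<lambda>u. symmetrized \<pi> (x0 - sqrt 2 * u)) j"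
proof -
  let ?\<kappa> = "\<lambda>u. hermite_psi j u * std_normal_density u"
  have sm [measurable]: "symmetrized \<pi> \<in> borel_measurable borel"
    unfolding symmetrized_def[abs_def] by measurable
  have aB: "\<bar>\<pi> z\<bar> \<le> B" for z using \<pi>0[of z] B[of z] by simp
  have im: "integrable lborel (\<lambda>z. ?\<kappa> ((x0 - z) / sqrt 2))"
    using lborel_integrable_affine[OF hermite_psi_density_integrable[of j], where c = "-1 / sqrt 2" and t = "x0 / sqrt 2"]
    by (simp add: diff_divide_distrib)
  have ip: "integrable lborel (\<lambda>z. ?\<kappa> ((x0 + z) / sqrt 2))"
    using lborel_integrable_affine[OF hermite_psi_density_integrable[of j], where c = "1 / sqrt 2" and t = "x0 / sqrt 2"]
    by (simp add: add_divide_distrib)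
  have i1: "integrable lborel (\<lambda>z. \<pi> z * ?\<kappa> ((x0 - z) / sqrt 2))"
    by (rule integrable_bounded_mult[OF _ aB im]) simp
  have i2: "integrable lborel (\<lambda>z. \<pi> z * ?\<kappa> ((x0 + z) / sqrt 2))"
    by (rule integrable_bounded_mult[OF _ aB ip]) simp
  have i3: "integrable lborel (\<lambda>z. \<pi> (- z) * ?\<kappa> ((x0 - z) / sqrt 2))"
    by (rule integrable_bounded_mult[OF _ aB im]) simp
  have "(\<integral>z. \<pi> z * (\<integral>x. std_normal_density (x - z) * hermite_kernel x0 j x \<partial>lborel) \<partial>lborel)
      = (\<integral>z. 2 powr (- real j / 2) / sqrt 2 *
          (\<pi> z * ?\<kappa> ((x0 - z) / sqrt 2) + \<pi> z * ?\<kappa> ((x0 + z) / sqrt 2)) \<partial>lborel)"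
    unfolding hermite_kernel_convolution by (intro Bochner_Integration.integral_cong) (auto simp: algebra_simps)
  also have "\<dots> = 2 powr (- real j / 2) / sqrt 2 *
      ((\<integral>z. \<pi> z * ?\<kappa> ((x0 - z) / sqrt 2) \<partial>lborel) + (\<integral>z. \<pi> z * ?\<kappa> ((x0 + z) / sqrt 2) \<partial>lborel))"
    by (simp only: integral_mult_right_zero Bochner_Integration.integral_add[OF i1 i2])
  also have "(\<integral>z. \<pi> z * ?\<kappa> ((x0 + z) / sqrt 2) \<partial>lborel) = (\<integral>z. \<pi> (- z) * ?\<kappa> ((x0 - z) / sqrt 2) \<partial>lborel)"
    by (subst lborel_integral_real_affine[where t = 0 and c = "-1"]) auto
  also have "(\<integral>z. \<pi> z * ?\<kappa> ((x0 - z) / sqrt 2) \<partial>lborel) + (\<integral>z. \<pi> (- z) * ?\<kappa> ((x0 - z) / sqrt 2) \<partial>lborel)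
      = (\<integral>z. 2 * (symmetrized \<pi> z * ?\<kappa> ((x0 - z) / sqrt 2)) \<partial>lborel)"
  proof -
    have "\<pi> z * ?\<kappa> ((x0 - z) / sqrt 2) + \<pi> (- z) * ?\<kappa> ((x0 - z) / sqrt 2)
        = 2 * (symmetrized \<pi> z * ?\<kappa> ((x0 - z) / sqrt 2))" for z
      by (simp add: symmetrized_def algebra_simps)
    then show ?thesis
      by (subst Bochner_Integration.integral_add[OF i1 i3, symmetric]) (simp only:)
  qed
  also have "\<dots> = 2 * (\<integral>z. symmetrized \<pi> z * ?\<kappa> ((x0 - z) / sqrt 2) \<partial>lborel)"
    by (rule integral_mult_right_zero)
  also have "(\<integral>z. symmetrized \<pi> z * ?\<kappa> ((x0 - z) / sqrt 2) \<partial>lborel)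
      = sqrt 2 * (\<integral>u. symmetrized \<pi> (x0 - sqrt 2 * u) * ?\<kappa> u \<partial>lborel)"
    by (subst lborel_integral_real_affine[where t = x0 and c = "- sqrt 2"]) auto
  also have "(\<integral>u. symmetrized \<pi> (x0 - sqrt 2 * u) * ?\<kappa> u \<partial>lborel)
      = hermite_coeff (\<lambda>u. symmetrized \<pi> (x0 - sqrt 2 * u)) j"
    unfolding hermite_coeff_def by (subst integral_std_normal_distribution) (auto simp: mult_ac)
  finally show ?thesis by simp
qed

text \<open>Since \<open>s\<close> is even, dividing by it cancels the selection weight in the law
  of the published absolute value, and the mean is that of the unselected model up to
  \<open>1 / c\<close>. Neither \<open>c\<close> nor \<open>C\<close> depends on \<open>j\<close>:
  the former lets the constant cancel in the final quotient, the latter controls the variance of the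
  whole series.\<close>

lemma published_abs_law_moments:
  assumes [measurable]: "\<pi> \<in> borel_measurable borel" "s \<in> borel_measurable borel"
    and \<pi>0: "\<And>z. 0 \<le> \<pi> z" and \<pi>1: "(\<integral>\<^sup>+z. ennreal (\<pi> z) \<partial>lborel) = 1" and B: "\<And>z. \<pi> z \<le> B"
    and s: "0 < \<delta>" "\<And>x. \<delta> \<le> s x" "\<And>x. s x \<le> 1" and even: "\<And>x. s (- x) = s x"
  obtains c C where "0 < c"
    "\<And>j. integrable (published_abs_law \<pi> s) (\<lambda>t. hermite_kernel x0 j t / s t)"
    "\<And>j. (\<integral>t. hermite_kernel x0 j t / s t \<partial>published_abs_law \<pi> s)
        = 2 / c * (2 powr (- real j / 2) * hermite_coeff (\<lambda>u. symmetrized \<pi> (x0 - sqrt 2 * u)) j)"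
    "\<And>j. integrable (published_abs_law \<pi> s) (\<lambda>t. (hermite_kernel x0 j t / s t)\<^sup>2)"
    "\<And>j. (\<integral>t. (hermite_kernel x0 j t / s t)\<^sup>2 \<partial>published_abs_law \<pi> s) \<le> C"
proof -
  obtain c where c: "0 < c" "c \<le> 1" and law: "published_abs_law \<pi> s = distr (density (lborel \<Otimes>\<^sub>M lborel)
        (\<lambda>(z, x). ennreal (\<pi> z * std_normal_density (x - z) * s x / c))) borel (\<lambda>(z, x). \<bar>x\<bar>)"
    by (rule published_abs_law_eq[OF assms(1,2) \<pi>0 \<pi>1 s])
  have s0: "0 < s x" for x using s(1) s(2)[of x] by linarith
  have B0: "0 \<le> B" using \<pi>0[of 0] B[of 0] by linarith
  have sabs: "s \<bar>x\<bar> = s x" for x using even by (auto simp: abs_if)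
  let ?k = "\<lambda>z x. \<pi> z * std_normal_density (x - z) * s x / c"
  have k0: "0 \<le> ?k z x" for z x using \<pi>0[of z] s0[of x] c by simp
  have kk [measurable]: "(\<lambda>w. ?k (fst w) (snd w)) \<in> borel_measurable (lborel \<Otimes>\<^sub>M lborel)" by measurable
  have law_int: "integrable (published_abs_law \<pi> s) F
        \<longleftrightarrow> integrable (lborel \<Otimes>\<^sub>M lborel) (\<lambda>w. ?k (fst w) (snd w) * F \<bar>snd w\<bar>)"
      "(\<integral>t. F t \<partial>published_abs_law \<pi> s) = (\<integral>w. ?k (fst w) (snd w) * F \<bar>snd w\<bar> \<partial>(lborel \<Otimes>\<^sub>M lborel))"
    if [measurable]: "F \<in> borel_measurable borel" for F :: "real \<Rightarrow> real"
  proof -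
    let ?D = "density (lborel \<Otimes>\<^sub>M lborel) (\<lambda>w. ennreal (?k (fst w) (snd w)))"
    have law': "published_abs_law \<pi> s = distr ?D borel (\<lambda>w. \<bar>snd w\<bar>)"
      unfolding law split_beta' ..
    have ab: "(\<lambda>w. \<bar>snd w\<bar>) \<in> measurable ?D borel" by simp
    have Fm: "(\<lambda>w. F \<bar>snd w\<bar>) \<in> borel_measurable (lborel \<Otimes>\<^sub>M lborel)" by measurable
    show "integrable (published_abs_law \<pi> s) F
        \<longleftrightarrow> integrable (lborel \<Otimes>\<^sub>M lborel) (\<lambda>w. ?k (fst w) (snd w) * F \<bar>snd w\<bar>)"
      unfolding law' integrable_distr_eq[OF ab that] using integrable_density[OF Fm kk AE_I2[OF k0]] by simp
    show "(\<integral>t. F t \<partial>published_abs_law \<pi> s) = (\<integral>w. ?k (fst w) (snd w) * F \<bar>snd w\<bar> \<partial>(lborel \<Otimes>\<^sub>M lborel))"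
      unfolding law' integral_distr[OF ab that] using integral_density[OF Fm kk AE_I2[OF k0]] by simp
  qed
  let ?K = "\<lambda>j t. hermite_kernel x0 j t / s t"
  let ?f1 = "\<lambda>j w. (case w of (z, x) \<Rightarrow> std_normal_density (x - z) * hermite_kernel x0 j x)"
  let ?f2 = "\<lambda>j w. (case w of (z, x) \<Rightarrow> std_normal_density (x - z) * (hermite_kernel x0 j x)\<^sup>2)"
  have e1: "?k (fst w) (snd w) * ?K j \<bar>snd w\<bar> = (\<pi> (fst w) * ?f1 j w) / c" for j w
    using s0[of "snd w"] by (cases w) (simp add: sabs)
  \<comment> \<open>In the square one factor \<open>s\<close> survives in the denominator; it is
    bounded below by \<delta>, and \<open>\<pi>\<close> above by \<open>B\<close>.\<close>
  have e2: "?k (fst w) (snd w) * (?K j \<bar>snd w\<bar>)\<^sup>2 \<le> B / (c * \<delta>) * ?f2 j w" for j w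
  proof -
    obtain z x where w: "w = (z, x)" by fastforce
    have "?k z x * (?K j \<bar>x\<bar>)\<^sup>2 = (\<pi> z / (c * s x)) * (std_normal_density (x - z) * (hermite_kernel x0 j x)\<^sup>2)"
      using s0[of x] c by (simp add: sabs power2_eq_square)
    also have "\<dots> \<le> B / (c * \<delta>) * (std_normal_density (x - z) * (hermite_kernel x0 j x)\<^sup>2)"
      using \<pi>0 B B0 s c by (intro mult_right_mono frac_le mult_left_mono) auto
    finally show ?thesis by (simp add: w)
  qed
  have i1: "integrable (lborel \<Otimes>\<^sub>M lborel) (\<lambda>w. \<pi> (fst w) * ?f1 j w)" for j
  proof (rule Bochner_Integration.integrable_bound)
    show "integrable (lborel \<Otimes>\<^sub>M lborel) (\<lambda>w. B * ?f1 j w)"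
      by (intro integrable_mult_right std_normal_convolution_integrable hermite_kernel_integrable)
    have "\<bar>\<pi> z\<bar> * a \<le> \<bar>B\<bar> * a" if "0 \<le> a" for z a
      using \<pi>0[of z] B[of z] B0 that by (intro mult_right_mono) auto
    then show "AE w in lborel \<Otimes>\<^sub>M lborel. norm (\<pi> (fst w) * ?f1 j w) \<le> norm (B * ?f1 j w)"
      by (simp add: abs_mult)
  qed measurable
  have i2: "integrable (lborel \<Otimes>\<^sub>M lborel) (\<lambda>w. B / (c * \<delta>) * ?f2 j w)" for j
    by (intro integrable_mult_right std_normal_convolution_integrable hermite_kernel_square_integral)
  have i3: "integrable (lborel \<Otimes>\<^sub>M lborel) (\<lambda>w. ?k (fst w) (snd w) * (?K j \<bar>snd w\<bar>)\<^sup>2)" for j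
  proof (rule Bochner_Integration.integrable_bound[OF i2[of j]])
    show "AE w in lborel \<Otimes>\<^sub>M lborel. norm (?k (fst w) (snd w) * (?K j \<bar>snd w\<bar>)\<^sup>2) \<le> norm (B / (c * \<delta>) * ?f2 j w)"
    proof (rule AE_I2)
      fix w
      have "0 \<le> ?k (fst w) (snd w) * (?K j \<bar>snd w\<bar>)\<^sup>2" by (intro mult_nonneg_nonneg k0) simp
      then show "norm (?k (fst w) (snd w) * (?K j \<bar>snd w\<bar>)\<^sup>2) \<le> norm (B / (c * \<delta>) * ?f2 j w)"
        using e2[of w j] unfolding real_norm_def by linarith
    qed
  qed measurable
  show thesis
  proof (rule that[OF c(1), of "B / (c * \<delta>) * 4"])
    fix j
    show "integrable (published_abs_law \<pi> s) (?K j)"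
      by (subst law_int(1)) (simp, simp only: e1, intro integrable_divide i1)
    have "(\<integral>t. ?K j t \<partial>published_abs_law \<pi> s) = (\<integral>w. \<pi> (fst w) * ?f1 j w \<partial>(lborel \<Otimes>\<^sub>M lborel)) / c"
      by (subst law_int(2)) (simp, simp only: e1 integral_divide_zero)
    also have "(\<integral>w. \<pi> (fst w) * ?f1 j w \<partial>(lborel \<Otimes>\<^sub>M lborel))
        = (\<integral>z. \<pi> z * (\<integral>x. std_normal_density (x - z) * hermite_kernel x0 j x \<partial>lborel) \<partial>lborel)"
      by (subst lborel_pair.integral_fst'[OF i1, symmetric]) simp
    also have "\<dots> = 2 * 2 powr (- real j / 2) * hermite_coeff (\<lambda>u. symmetrized \<pi> (x0 - sqrt 2 * u)) j"
      by (rule symmetrized_kernel_integral[OF _ \<pi>0 B]) simp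
    finally show "(\<integral>t. ?K j t \<partial>published_abs_law \<pi> s)
        = 2 / c * (2 powr (- real j / 2) * hermite_coeff (\<lambda>u. symmetrized \<pi> (x0 - sqrt 2 * u)) j)"
      by simp
    show "integrable (published_abs_law \<pi> s) (\<lambda>t. (?K j t)\<^sup>2)"
      by (subst law_int(1)) (simp, rule i3)
    have "(\<integral>t. (?K j t)\<^sup>2 \<partial>published_abs_law \<pi> s) = (\<integral>w. ?k (fst w) (snd w) * (?K j \<bar>snd w\<bar>)\<^sup>2 \<partial>(lborel \<Otimes>\<^sub>M lborel))"
      by (subst law_int(2)) simp_all
    also have "\<dots> \<le> (\<integral>w. B / (c * \<delta>) * ?f2 j w \<partial>(lborel \<Otimes>\<^sub>M lborel))"
      by (intro integral_mono i3 i2 e2)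
    also have "\<dots> = B / (c * \<delta>) * (\<integral>x. (hermite_kernel x0 j x)\<^sup>2 \<partial>lborel)"
      by (simp only: integral_mult_right_zero
          std_normal_convolution_integrable(2)[OF hermite_kernel_square_integral(1)])
    also have "\<dots> \<le> B / (c * \<delta>) * 4"
      using B0 c s by (intro mult_left_mono hermite_kernel_square_integral) auto
    finally show "(\<integral>t. (?K j t)\<^sup>2 \<partial>published_abs_law \<pi> s) \<le> B / (c * \<delta>) * 4" .
  qed
qed

section \<open>The series estimator\<close>

lemma coeff_b_hat_eq:
  "coeff_b_hat p n g x j = sqrt 2 ^ j * ((\<Sum>i=1..n. hermite_kernel (cv p) j (x i) / g (x i)) / real n)"
proof -
  have "2 powr (real j / 2) = sqrt 2 ^ j"
    by (simp add: powr_half_sqrt[symmetric] powr_powr flip: powr_realpow)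
  moreover have "hermite_psi j (cv p - \<bar>t\<bar>) * std_normal_density (cv p - \<bar>t\<bar>)
         + hermite_psi j (cv p + \<bar>t\<bar>) * std_normal_density (cv p + \<bar>t\<bar>) = hermite_kernel (cv p) j t" for t
    using hermite_kernel_abs[of "cv p" j t] by (simp only: hermite_kernel_def)
  ultimately show ?thesis by (simp add: coeff_b_hat_def)
qed

text \<open>Cauchy-Schwarz with each \<open>\<bar>\<beta> j\<bar>\<close> split into two square
  roots. With uniform second moments it bounds the variance through the sum of the
  \<open>\<bar>\<beta> j\<bar>\<close>, the same quantity that controls the plug-in error.\<close>

lemma weighted_sum_square_le:
  fixes \<beta> K :: "nat \<Rightarrow> real"
  shows "(\<Sum>j\<le>J. \<beta> j * K j)\<^sup>2 \<le> (\<Sum>j\<le>J. \<bar>\<beta> j\<bar>) * (\<Sum>j\<le>J. \<bar>\<beta> j\<bar> * (K j)\<^sup>2)"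
proof -
  have "(\<Sum>j\<le>J. \<beta> j * K j) = (\<Sum>j\<le>J. sqrt \<bar>\<beta> j\<bar> * (sgn (\<beta> j) * sqrt \<bar>\<beta> j\<bar> * K j))"
  proof (intro sum.cong refl)
    fix j
    have "\<beta> j * K j = (sqrt \<bar>\<beta> j\<bar> * sqrt \<bar>\<beta> j\<bar>) * sgn (\<beta> j) * K j"
      by (simp add: abs_mult_sgn)
    then show "\<beta> j * K j = sqrt \<bar>\<beta> j\<bar> * (sgn (\<beta> j) * sqrt \<bar>\<beta> j\<bar> * K j)" by (simp only: mult_ac)
  qed
  also have "\<dots>\<^sup>2 \<le> (\<Sum>j\<le>J. (sqrt \<bar>\<beta> j\<bar>)\<^sup>2) * (\<Sum>j\<le>J. (sgn (\<beta> j) * sqrt \<bar>\<beta> j\<bar> * K j)\<^sup>2)"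
    by (rule Cauchy_Schwarz_ineq_sum)
  also have "(\<Sum>j\<le>J. (sgn (\<beta> j) * sqrt \<bar>\<beta> j\<bar> * K j)\<^sup>2) = (\<Sum>j\<le>J. \<bar>\<beta> j\<bar> * (K j)\<^sup>2)"
    by (intro sum.cong refl) (auto simp: power_mult_distrib sgn_if)
  finally show ?thesis by simp
qed

text \<open>Numerator and denominator of the estimator are two instances of \<open>h\<close>. The
  oracle average \<open>R\<close>, built with the true \<open>s\<close>, converges by its second
  moment about \<open>m n\<close>; the plug-in version differs from it by at most
  \<open>\<bar>X n \<omega>\<bar> * Q n \<omega>\<close>.\<close>

lemma series_estimator_converges:
  fixes M :: "nat \<Rightarrow> 'w measure" and art :: "nat \<Rightarrow> nat \<Rightarrow> 'art"
  assumes M: "\<And>n. prob_space (M n)"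
    and Z: "\<And>n i. i \<in> {1..n} \<Longrightarrow> Z n i \<in> borel_measurable (M n)"
    and ind: "\<And>n. indep_across_articles (M n) n (art n) (Z n)"
    and L: "\<And>n a. card (article_obs n (art n) a) \<le> L"
    and s [measurable]: "s \<in> borel_measurable borel" and s01: "\<And>t. 0 < s t" "\<And>t. s t \<le> 1"
    and i1: "\<And>n i j. i \<in> {1..n} \<Longrightarrow> integrable (M n) (\<lambda>\<omega>. hermite_kernel (cv p) j (Z n i \<omega>) / s (Z n i \<omega>))"
    and mean: "\<And>n i j. i \<in> {1..n} \<Longrightarrow> (\<integral>\<omega>. hermite_kernel (cv p) j (Z n i \<omega>) / s (Z n i \<omega>) \<partial>M n)
        = 2 / c * (2 powr (- real j / 2) * hermite_coeff g j)"
    and i2: "\<And>n i j. i \<in> {1..n} \<Longrightarrow> integrable (M n) (\<lambda>\<omega>. (hermite_kernel (cv p) j (Z n i \<omega>) / s (Z n i \<omega>))\<^sup>2)"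
    and C: "\<And>n i j. i \<in> {1..n} \<Longrightarrow> (\<integral>\<omega>. (hermite_kernel (cv p) j (Z n i \<omega>) / s (Z n i \<omega>))\<^sup>2 \<partial>M n) \<le> C"
    and X: "bounded_in_prob M X"
    and s_hat: "\<And>n \<omega> t. 1 \<le> n \<Longrightarrow> \<omega> \<in> space (M n) \<Longrightarrow>
        \<bar>1 / s_hat n \<omega> t - 1 / s t\<bar> \<le> \<bar>X n \<omega>\<bar> / real n powr (1 / 3)"
    and A: "0 < A"
    and h: "continuous_on UNIV h" "\<And>u. \<bar>h u\<bar> \<le> H"
    and g [measurable]: "g \<in> borel_measurable borel" and G: "\<And>u. \<bar>g u\<bar> \<le> G"
  shows "converges_in_prob M
      (\<lambda>n \<omega>. \<Sum>j=0..trunc_J A n. hermite_coeff h j * coeff_b_hat p n (s_hat n \<omega>) (\<lambda>i. Z n i \<omega>) j)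
      (2 / c * (\<integral>u. h u * g u \<partial>std_normal_distribution))"
proof -
  have [measurable]: "h \<in> borel_measurable borel" by (rule borel_measurable_continuous_onI[OF h(1)])
  define K where "K j t = hermite_kernel (cv p) j t / s t" for j t
  have Km [measurable]: "K j \<in> borel_measurable borel" for j unfolding K_def[abs_def] by measurable
  note i1 = i1[folded K_def] and mean = mean[folded K_def] and i2 = i2[folded K_def] and C = C[folded K_def]
  \<comment> \<open>The factor \<open>sqrt 2 ^ j\<close> is the \<open>2 powr (j / 2)\<close> of
    \<open>coeff_b_hat\<close>; it cancels against the mean of the kernel in \<open>m\<close>, but
    stays in the variance.\<close>
  define \<beta> where "\<beta> j = hermite_coeff h j * sqrt 2 ^ j" for j
  define Y where "Y n t = (\<Sum>j\<le>trunc_J A n. \<beta> j * K j t)" for n t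
  have Ym [measurable]: "Y n \<in> borel_measurable borel" for n unfolding Y_def[abs_def] by measurable
  define W where "W n = (\<Sum>j\<le>trunc_J A n. \<bar>\<beta> j\<bar>)" for n
  have W0: "0 \<le> W n" for n unfolding W_def by (intro sum_nonneg) auto
  have W: "(\<lambda>n. W n / real n powr (1 / 3)) \<longlonglongrightarrow> 0"
    using truncated_weighted_sum_tendsto_0[OF hermite_coeff_tendsto_0[OF _ h(2)] A]
    by (simp add: W_def \<beta>_def abs_mult)
  have C0: "0 \<le> C"
    using C[of 1 1 0] by (intro order_trans[OF _ C[of 1 1 0]]) auto
  define R where "R n \<omega> = (\<Sum>i=1..n. Y n (Z n i \<omega>)) / real n" for n \<omega>
  define m where "m n = (\<Sum>j\<le>trunc_J A n. \<beta> j * (2 / c * (2 powr (- real j / 2) * hermite_coeff g j)))" for n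
  have Y1: "integrable (M n) (\<lambda>\<omega>. Y n (Z n i \<omega>))" "(\<integral>\<omega>. Y n (Z n i \<omega>) \<partial>M n) = m n"
    if i: "i \<in> {1..n}" for n i
    using i1[OF i] mean[OF i] by (auto simp: Y_def m_def)
  have Y_sq: "(Y n t)\<^sup>2 \<le> W n * (\<Sum>j\<le>trunc_J A n. \<bar>\<beta> j\<bar> * (K j t)\<^sup>2)" for n t
    unfolding Y_def W_def by (rule weighted_sum_square_le)
  have iY: "integrable (M n) (\<lambda>\<omega>. W n * (\<Sum>j\<le>trunc_J A n. \<bar>\<beta> j\<bar> * (K j (Z n i \<omega>))\<^sup>2))" if i: "i \<in> {1..n}" for n i
    by (intro integrable_mult_right Bochner_Integration.integrable_sum i2[OF i])
  have Y2: "integrable (M n) (\<lambda>\<omega>. (Y n (Z n i \<omega>))\<^sup>2)" if i: "i \<in> {1..n}" for n i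
  proof (rule Bochner_Integration.integrable_bound[OF iY[OF i]])
    show "(\<lambda>\<omega>. (Y n (Z n i \<omega>))\<^sup>2) \<in> borel_measurable (M n)"
      using measurable_compose[OF Z[OF i] Ym] by simp
  qed (auto intro!: AE_I2 order_trans[OF Y_sq] abs_ge_self)
  have YV: "(\<integral>\<omega>. (Y n (Z n i \<omega>))\<^sup>2 \<partial>M n) \<le> (W n)\<^sup>2 * C" if i: "i \<in> {1..n}" for n i
  proof -
    have "(\<integral>\<omega>. (Y n (Z n i \<omega>))\<^sup>2 \<partial>M n) \<le> (\<integral>\<omega>. W n * (\<Sum>j\<le>trunc_J A n. \<bar>\<beta> j\<bar> * (K j (Z n i \<omega>))\<^sup>2) \<partial>M n)"
      by (intro integral_mono Y2 iY i Y_sq)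
    also have "\<dots> = W n * (\<Sum>j\<le>trunc_J A n. \<bar>\<beta> j\<bar> * (\<integral>\<omega>. (K j (Z n i \<omega>))\<^sup>2 \<partial>M n))"
      using i2[OF i] by simp
    also have "\<dots> \<le> W n * (\<Sum>j\<le>trunc_J A n. \<bar>\<beta> j\<bar> * C)"
      using C[OF i] W0 by (intro mult_left_mono sum_mono) auto
    also have "\<dots> = W n * (W n * C)" by (simp only: W_def sum_distrib_right)
    also have "\<dots> = (W n)\<^sup>2 * C" by (simp add: power2_eq_square)
    finally show ?thesis .
  qed
  have "(\<lambda>n. 2 / c * (\<Sum>j\<le>trunc_J A n. hermite_coeff h j * hermite_coeff g j))
      \<longlonglongrightarrow> 2 / c * (\<integral>u. h u * g u \<partial>std_normal_distribution)"
    by (intro tendsto_mult_left filterlim_compose[OF hermite_parseval[OF h g G] trunc_J_at_top[OF A]])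
  moreover have "m = (\<lambda>n. 2 / c * (\<Sum>j\<le>trunc_J A n. hermite_coeff h j * hermite_coeff g j))"
  proof
    fix n
    have "sqrt 2 ^ j * 2 powr (- real j / 2) = 1" for j
    proof -
      have "sqrt 2 ^ j = 2 powr (real j / 2)"
        by (simp add: powr_half_sqrt[symmetric] powr_powr flip: powr_realpow)
      then show ?thesis by (simp flip: powr_add)
    qed
    then have "\<beta> j * (2 / c * (2 powr (- real j / 2) * hermite_coeff g j))
        = 2 / c * (hermite_coeff h j * hermite_coeff g j)" for j
      by (simp add: \<beta>_def mult_ac)
    then show "m n = 2 / c * (\<Sum>j\<le>trunc_J A n. hermite_coeff h j * hermite_coeff g j)"
      unfolding m_def sum_distrib_left by (intro sum.cong) auto
  qed
  ultimately have m: "m \<longlonglongrightarrow> 2 / c * (\<integral>u. h u * g u \<partial>std_normal_distribution)" by (simp only:)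
  \<comment> \<open>\<open>W n\<close> is of smaller order than the cube root of \<open>n\<close>,
    and the square of that cube root is at most \<open>n\<close>. This crude comparison already
    suffices.\<close>
  have V: "(\<lambda>n. real L * ((W n)\<^sup>2 * C) / real n) \<longlonglongrightarrow> 0"
  proof (rule tendsto_sandwich[OF _ _ tendsto_const])
    have "(\<lambda>n. real L * C * (W n / real n powr (1 / 3))\<^sup>2) \<longlonglongrightarrow> real L * C * 0\<^sup>2"
      by (intro tendsto_intros W)
    then show "(\<lambda>n. real L * C * (W n / real n powr (1 / 3))\<^sup>2) \<longlonglongrightarrow> 0" by simp
    show "eventually (\<lambda>n. 0 \<le> real L * ((W n)\<^sup>2 * C) / real n) sequentially"
      using C0 by (intro always_eventually allI) simp
    show "eventually (\<lambda>n. real L * ((W n)\<^sup>2 * C) / real n \<le> real L * C * (W n / real n powr (1 / 3))\<^sup>2) sequentially"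
      using eventually_ge_at_top[of 1]
    proof eventually_elim
      case (elim n)
      have "(real n powr (1 / 3))\<^sup>2 = real n powr (2 / 3)"
        using elim by (simp add: power2_eq_square flip: powr_add)
      also have "\<dots> \<le> real n powr 1" using elim by (intro powr_mono) auto
      finally have "(real n powr (1 / 3))\<^sup>2 \<le> real n" using elim by simp
      then have "real L * C * (W n)\<^sup>2 / real n \<le> real L * C * (W n)\<^sup>2 / (real n powr (1 / 3))\<^sup>2"
        using elim C0 by (intro divide_left_mono) auto
      then show ?case by (simp add: power_divide mult_ac)
    qed
  qed
  have R: "converges_in_prob M R (2 / c * (\<integral>u. h u * g u \<partial>std_normal_distribution))"
  proof (rule converges_in_prob_second_moment[OF M _ V m])
    show "eventually (\<lambda>n. R n \<in> borel_measurable (M n) \<and> integrable (M n) (\<lambda>\<omega>. (R n \<omega> - m n)\<^sup>2)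
      \<and> (\<integral>\<omega>. (R n \<omega> - m n)\<^sup>2 \<partial>M n) \<le> real L * ((W n)\<^sup>2 * C) / real n) sequentially"
      using eventually_ge_at_top[of 1]
    proof eventually_elim
      case (elim n)
      have "R n \<in> borel_measurable (M n)"
        unfolding R_def[abs_def] using measurable_compose[OF Z Ym] by (intro borel_measurable_divide borel_measurable_sum) auto
      then show ?case
        using article_mean_variance[OF M ind L elim Z Ym Y1(1) Y2 Y1(2) YV] by (simp add: R_def)
    qed
  qed
  \<comment> \<open>Only the true selection function enters through \<open>K\<close>, so
    \<open>Q\<close> is measurable and its mean can be computed even though the plug-in estimator
    may be nonmeasurable.\<close>
  define Q where "Q n \<omega> = (\<Sum>j\<le>trunc_J A n. \<bar>\<beta> j\<bar> * ((\<Sum>i=1..n. \<bar>K j (Z n i \<omega>)\<bar>) / real n)) / real n powr (1 / 3)" for n \<omega>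
  show ?thesis
  proof (rule converges_in_prob_perturb[OF M R X])
    have "(\<lambda>n. (1 + C) * (W n / real n powr (1 / 3))) \<longlonglongrightarrow> (1 + C) * 0"
      by (intro tendsto_intros W)
    then show "(\<lambda>n. (1 + C) * (W n / real n powr (1 / 3))) \<longlonglongrightarrow> 0" by simp
    show "eventually (\<lambda>n. integrable (M n) (Q n) \<and> (\<forall>\<omega>\<in>space (M n). 0 \<le> Q n \<omega>)
      \<and> (\<integral>\<omega>. Q n \<omega> \<partial>M n) \<le> (1 + C) * (W n / real n powr (1 / 3))) sequentially"
      using eventually_ge_at_top[of 1]
    proof eventually_elim
      case (elim n)
      interpret prob_space "M n" by (rule M)
      have iK: "integrable (M n) (\<lambda>\<omega>. \<bar>K j (Z n i \<omega>)\<bar>)" if "i \<in> {1..n}" for i j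
        using i1[OF that] by (rule integrable_abs)
      \<comment> \<open>The second moment bound \<open>C\<close> also yields a first absolute moment
        bound, uniform in \<open>j\<close>.\<close>
      have EK: "expectation (\<lambda>\<omega>. \<bar>K j (Z n i \<omega>)\<bar>) \<le> 1 + C" if i: "i \<in> {1..n}" for i j
      proof -
        have "\<bar>x\<bar> \<le> 1 + x\<^sup>2" for x :: real
        proof -
          have "0 \<le> (\<bar>x\<bar> - 1)\<^sup>2 + x\<^sup>2 + 1" by simp
          then show ?thesis by (simp add: power2_diff)
        qed
        then have "expectation (\<lambda>\<omega>. \<bar>K j (Z n i \<omega>)\<bar>) \<le> expectation (\<lambda>\<omega>. 1 + (K j (Z n i \<omega>))\<^sup>2)"
          using i2[OF i] by (intro integral_mono iK i) auto
        also have "\<dots> = 1 + expectation (\<lambda>\<omega>. (K j (Z n i \<omega>))\<^sup>2)" using i2[OF i] by (simp add: prob_space)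
        finally show ?thesis using C[OF i, of j] by linarith
      qed
      have int: "integrable (M n) (Q n)"
        unfolding Q_def[abs_def]
        by (intro integrable_divide Bochner_Integration.integrable_sum integrable_mult_right iK)
      have "expectation (Q n)
          = (\<Sum>j\<le>trunc_J A n. \<bar>\<beta> j\<bar> * ((\<Sum>i=1..n. expectation (\<lambda>\<omega>. \<bar>K j (Z n i \<omega>)\<bar>)) / real n)) / real n powr (1 / 3)"
      proof -
        have "expectation (\<lambda>\<omega>. \<Sum>i=1..n. \<bar>K j (Z n i \<omega>)\<bar>) = (\<Sum>i=1..n. expectation (\<lambda>\<omega>. \<bar>K j (Z n i \<omega>)\<bar>))" for j
          by (intro Bochner_Integration.integral_sum iK)
        moreover have "expectation (\<lambda>\<omega>. \<Sum>j\<le>trunc_J A n. \<bar>\<beta> j\<bar> * ((\<Sum>i=1..n. \<bar>K j (Z n i \<omega>)\<bar>) / real n))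
            = (\<Sum>j\<le>trunc_J A n. expectation (\<lambda>\<omega>. \<bar>\<beta> j\<bar> * ((\<Sum>i=1..n. \<bar>K j (Z n i \<omega>)\<bar>) / real n)))"
          by (intro Bochner_Integration.integral_sum integrable_divide Bochner_Integration.integrable_sum
              integrable_mult_right iK)
        ultimately show ?thesis
          unfolding Q_def[abs_def] by (simp only: integral_divide_zero integral_mult_right_zero)
      qed
      also have "\<dots> \<le> (\<Sum>j\<le>trunc_J A n. \<bar>\<beta> j\<bar> * (1 + C)) / real n powr (1 / 3)"
      proof (intro divide_right_mono sum_mono mult_left_mono)
        fix j
        have "(\<Sum>i=1..n. expectation (\<lambda>\<omega>. \<bar>K j (Z n i \<omega>)\<bar>)) \<le> (\<Sum>i=1..n. 1 + C)"
          by (intro sum_mono EK)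
        then show "(\<Sum>i=1..n. expectation (\<lambda>\<omega>. \<bar>K j (Z n i \<omega>)\<bar>)) / real n \<le> 1 + C"
          using elim by (subst pos_divide_le_eq) (auto simp: mult.commute)
      qed auto
      also have "\<dots> = (1 + C) * (W n / real n powr (1 / 3))"
        by (simp add: W_def sum_distrib_right[symmetric] mult.commute)
      finally have "expectation (Q n) \<le> (1 + C) * (W n / real n powr (1 / 3))" .
      moreover have "\<forall>\<omega>\<in>space (M n). 0 \<le> Q n \<omega>"
        unfolding Q_def by (intro ballI divide_nonneg_nonneg sum_nonneg mult_nonneg_nonneg) auto
      ultimately show ?case using int by blast
    qed
    show "eventually (\<lambda>n. \<forall>\<omega>\<in>space (M n).
        \<bar>(\<Sum>j=0..trunc_J A n. hermite_coeff h j * coeff_b_hat p n (s_hat n \<omega>) (\<lambda>i. Z n i \<omega>) j) - R n \<omega>\<bar>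
        \<le> \<bar>X n \<omega>\<bar> * Q n \<omega>) sequentially"
      using eventually_ge_at_top[of 1]
    proof eventually_elim
      case (elim n)
      show ?case
      proof
        fix \<omega> assume \<omega>: "\<omega> \<in> space (M n)"
        let ?hk = "\<lambda>j i. hermite_kernel (cv p) j (Z n i \<omega>)"
        let ?x = "\<bar>X n \<omega>\<bar> / real n powr (1 / 3)"
        have "R n \<omega> = (\<Sum>j\<le>trunc_J A n. \<beta> j * ((\<Sum>i=1..n. K j (Z n i \<omega>)) / real n))"
          unfolding R_def Y_def by (subst sum.swap) (simp add: sum_divide_distrib sum_distrib_left)
        moreover have "(\<Sum>j=0..trunc_J A n. hermite_coeff h j * coeff_b_hat p n (s_hat n \<omega>) (\<lambda>i. Z n i \<omega>) j)
            = (\<Sum>j\<le>trunc_J A n. \<beta> j * ((\<Sum>i=1..n. ?hk j i / s_hat n \<omega> (Z n i \<omega>)) / real n))"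
          by (simp add: coeff_b_hat_eq \<beta>_def atLeast0AtMost mult.assoc)
        ultimately have eq: "(\<Sum>j=0..trunc_J A n. hermite_coeff h j * coeff_b_hat p n (s_hat n \<omega>) (\<lambda>i. Z n i \<omega>) j) - R n \<omega>
            = (\<Sum>j\<le>trunc_J A n. \<beta> j * ((\<Sum>i=1..n. ?hk j i / s_hat n \<omega> (Z n i \<omega>) - K j (Z n i \<omega>)) / real n))"
          by (simp only: sum_subtractf diff_divide_distrib right_diff_distrib)
        have term_le: "\<bar>?hk j i / s_hat n \<omega> (Z n i \<omega>) - K j (Z n i \<omega>)\<bar> \<le> \<bar>K j (Z n i \<omega>)\<bar> * ?x" for i j
        proof -
          have "?hk j i / s_hat n \<omega> (Z n i \<omega>) - K j (Z n i \<omega>)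
              = ?hk j i * (1 / s_hat n \<omega> (Z n i \<omega>) - 1 / s (Z n i \<omega>))"
            by (simp add: K_def right_diff_distrib)
          \<comment> \<open>As \<open>s\<close> is at most 1, dividing by it only enlarges the
            kernel. This expresses the error through \<open>K\<close>, whose moments are
            known.\<close>
          moreover have "\<bar>?hk j i\<bar> \<le> \<bar>K j (Z n i \<omega>)\<bar>"
          proof -
            have "\<bar>?hk j i\<bar> * s (Z n i \<omega>) \<le> \<bar>?hk j i\<bar>"
              using s01 by (intro mult_right_le_one_le) (auto intro: less_imp_le)
            then show ?thesis using s01(1)[of "Z n i \<omega>"] by (simp add: K_def pos_le_divide_eq)
          qed
          ultimately show ?thesis
            using s_hat[OF elim \<omega>, of "Z n i \<omega>"] by (simp add: abs_mult mult_mono del: times_divide_eq_right)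
        qed
        have "\<bar>\<Sum>j\<le>trunc_J A n. \<beta> j * ((\<Sum>i=1..n. ?hk j i / s_hat n \<omega> (Z n i \<omega>) - K j (Z n i \<omega>)) / real n)\<bar>
            \<le> (\<Sum>j\<le>trunc_J A n. \<bar>\<beta> j\<bar> * ((\<Sum>i=1..n. \<bar>K j (Z n i \<omega>)\<bar> * ?x) / real n))"
        proof (intro order_trans[OF sum_abs] sum_mono)
          fix j
          have "\<bar>\<Sum>i=1..n. ?hk j i / s_hat n \<omega> (Z n i \<omega>) - K j (Z n i \<omega>)\<bar> \<le> (\<Sum>i=1..n. \<bar>K j (Z n i \<omega>)\<bar> * ?x)"
            by (intro order_trans[OF sum_abs] sum_mono term_le)
          then show "\<bar>\<beta> j * ((\<Sum>i=1..n. ?hk j i / s_hat n \<omega> (Z n i \<omega>) - K j (Z n i \<omega>)) / real n)\<bar>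
              \<le> \<bar>\<beta> j\<bar> * ((\<Sum>i=1..n. \<bar>K j (Z n i \<omega>)\<bar> * ?x) / real n)"
            unfolding abs_mult abs_divide by (intro mult_left_mono) (auto intro: divide_right_mono)
        qed
        also have "\<dots> = \<bar>X n \<omega>\<bar> * Q n \<omega>"
          unfolding Q_def sum_distrib_right[symmetric]
          by (simp add: sum_distrib_left sum_divide_distrib mult_ac)
        finally show "\<bar>(\<Sum>j=0..trunc_J A n. hermite_coeff h j * coeff_b_hat p n (s_hat n \<omega>) (\<lambda>i. Z n i \<omega>) j) - R n \<omega>\<bar>
            \<le> \<bar>X n \<omega>\<bar> * Q n \<omega>"
          unfolding eq .
      qed
    qed
  qed
qed

section \<open>Predictive power as a quotient of Gaussian inner products\<close>

lemma std_normal_cdf_bounds: "0 \<le> std_normal_cdf x" "std_normal_cdf x \<le> 1"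
proof -
  interpret real_distribution std_normal_distribution by (rule real_dist_normal_dist)
  show "0 \<le> std_normal_cdf x" "std_normal_cdf x \<le> 1"
    by (auto simp: std_normal_cdf_def cdf_nonneg cdf_bounded_prob)
qed

lemma isCont_std_normal_cdf: "isCont std_normal_cdf x"
proof -
  interpret real_distribution std_normal_distribution by (rule real_dist_normal_dist)
  have "emeasure std_normal_distribution {x} = 0"
    by (subst emeasure_density) (auto intro!: nn_integral_0_iff_AE[THEN iffD2] AE_mp[OF AE_lborel_singleton[of x]])
  then have "isCont (cdf std_normal_distribution) x"
    by (simp add: isCont_cdf measure_def)
  then show ?thesis unfolding std_normal_cdf_def[abs_def] .
qed

lemma continuous_on_std_normal_cdf [continuous_intros]:
  "continuous_on S f \<Longrightarrow> continuous_on S (\<lambda>x. std_normal_cdf (f x))"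
  by (rule continuous_on_compose2[of UNIV std_normal_cdf])
     (auto intro: continuous_at_imp_continuous_on isCont_std_normal_cdf)

lemma std_normal_cdf_measurable [measurable]: "std_normal_cdf \<in> borel_measurable borel"
  by (intro borel_measurable_continuous_onI continuous_at_imp_continuous_on ballI isCont_std_normal_cdf)

lemma coeff_a_eq:
  "coeff_a p j = hermite_coeff (\<lambda>u. exp (- u\<^sup>2 / 2) * std_normal_cdf (1.96 - cv p + sqrt 2 * u)) j"
  unfolding coeff_a_def hermite_coeff_def by (subst integral_std_normal_distribution) (auto simp: mult_ac)

lemma coeff_d_eq: "coeff_d j = hermite_coeff (\<lambda>u. exp (- u\<^sup>2 / 2)) j"
  unfolding coeff_d_def hermite_coeff_def by (subst integral_std_normal_distribution) (auto simp: mult_ac)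

text \<open>At \<open>sqrt 2 * u\<close> the normal density equals the density at \<open>u\<close>
  times \<open>exp (- u\<^sup>2 / 2)\<close>. This is the origin of the exponential factor in
  \<open>coeff_a\<close> and \<open>coeff_d\<close>.\<close>

lemma std_normal_integral_rescale:
  assumes [measurable]: "f \<in> borel_measurable borel"
  shows "(\<integral>z. std_normal_density (x0 - z) * f z \<partial>lborel)
    = sqrt 2 * (\<integral>u. exp (- u\<^sup>2 / 2) * f (x0 - sqrt 2 * u) \<partial>std_normal_distribution)"
proof -
  have "std_normal_density (sqrt 2 * u) = std_normal_density u * exp (- u\<^sup>2 / 2)" for u
  proof -
    have "exp (- (sqrt 2 * u)\<^sup>2 / 2) = exp (- u\<^sup>2 / 2) * exp (- u\<^sup>2 / 2)"
      by (simp add: exp_add[symmetric] power_mult_distrib)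
    then show ?thesis by (simp only: std_normal_density_def mult.assoc)
  qed
  then have "std_normal_density (x0 - (x0 + - sqrt 2 * u)) * f (x0 + - sqrt 2 * u)
      = std_normal_density u * (exp (- u\<^sup>2 / 2) * f (x0 - sqrt 2 * u))" for u
    by (simp add: mult.assoc)
  then have "(\<integral>u. std_normal_density (x0 - (x0 + - sqrt 2 * u)) * f (x0 + - sqrt 2 * u) \<partial>lborel)
      = (\<integral>u. exp (- u\<^sup>2 / 2) * f (x0 - sqrt 2 * u) \<partial>std_normal_distribution)"
    by (subst integral_std_normal_distribution) (measurable, simp only:)
  then show ?thesis
    by (subst lborel_integral_real_affine[where t = x0 and c = "- sqrt 2"]) auto
qed

text \<open>The Jacobian \<open>sqrt 2\<close> appears in numerator and denominator and cancels.
  Positivity of the denominator is what later makes the quotient continuous at the limit.\<close>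

lemma predictive_power_eq:
  fixes p :: real
  assumes [measurable]: "\<pi> \<in> borel_measurable borel" and \<pi>0: "\<And>z. 0 \<le> \<pi> z" and B: "\<And>z. \<pi> z \<le> B"
    and \<pi>1: "(\<integral>\<^sup>+z. ennreal (\<pi> z) \<partial>lborel) = 1"
  defines "g \<equiv> \<lambda>u. symmetrized \<pi> (cv p - sqrt 2 * u)"
  shows "0 < (\<integral>u. exp (- u\<^sup>2 / 2) * g u \<partial>std_normal_distribution)"
    and "predictive_power \<pi> p = 1 - (\<integral>u. exp (- u\<^sup>2 / 2) * std_normal_cdf (1.96 - cv p + sqrt 2 * u) * g u
          \<partial>std_normal_distribution) / (\<integral>u. exp (- u\<^sup>2 / 2) * g u \<partial>std_normal_distribution)"
proof -
  let ?x = "cv p"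
  let ?s = "symmetrized \<pi>"
  have sm [measurable]: "?s \<in> borel_measurable borel"
    unfolding symmetrized_def[abs_def] by measurable
  have s0: "0 \<le> ?s z" for z using \<pi>0 by (simp add: symmetrized_def)
  have sB: "?s z \<le> B" for z using B[of z] B[of "- z"] by (simp add: symmetrized_def)
  have phi: "integrable lborel (\<lambda>z. std_normal_density (?x - z))"
    using lborel_integrable_affine[of std_normal_density "-1" ?x] by simp
  have iD: "integrable lborel (\<lambda>z. std_normal_density (?x - z) * ?s z)"
    using integrable_bounded_mult[OF sm _ phi, of B] s0 sB by (simp add: mult.commute)
  have iN: "integrable lborel (\<lambda>z. std_normal_density (?x - z) * (std_normal_cdf (1.96 - z) * ?s z))"
    using integrable_bounded_mult[OF _ _ iD, of "\<lambda>z. std_normal_cdf (1.96 - z)" 1] std_normal_cdf_bounds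
    by (simp add: mult_ac)
  define D where "D = (\<integral>z. std_normal_density (?x - z) * ?s z \<partial>lborel)"
  define N where "N = (\<integral>z. std_normal_density (?x - z) * (std_normal_cdf (1.96 - z) * ?s z) \<partial>lborel)"
  have D: "D = sqrt 2 * (\<integral>u. exp (- u\<^sup>2 / 2) * g u \<partial>std_normal_distribution)"
    unfolding D_def g_def by (rule std_normal_integral_rescale) simp
  have N: "N = sqrt 2 * (\<integral>u. exp (- u\<^sup>2 / 2) * std_normal_cdf (1.96 - cv p + sqrt 2 * u) * g u \<partial>std_normal_distribution)"
    unfolding N_def g_def by (subst std_normal_integral_rescale) (auto simp: mult.assoc algebra_simps)
  \<comment> \<open>The normal density vanishes nowhere, so a zero integral would force
    \<open>symmetrized \<pi>\<close>, and with it the nonnegative \<open>\<pi>\<close>, to vanish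
    almost everywhere, against total mass 1.\<close>
  have pos: "0 < D"
  proof (rule ccontr)
    assume "\<not> 0 < D"
    moreover have "0 \<le> D" unfolding D_def using s0 by (intro Bochner_Integration.integral_nonneg) auto
    ultimately have "D = 0" by simp
    then have "AE z in lborel. std_normal_density (?x - z) * ?s z = 0"
      unfolding D_def using integral_nonneg_eq_0_iff_AE[OF iD] s0 by simp
    moreover have "0 < std_normal_density (?x - z)" for z by (rule normal_density_pos) simp
    then have "std_normal_density (?x - z) \<noteq> 0" for z by (metis less_irrefl)
    ultimately have "AE z in lborel. ?s z = 0" by simp
    then have "AE z in lborel. \<pi> z = 0"
      by eventually_elim (use \<pi>0 in \<open>simp add: symmetrized_def add_nonneg_eq_0_iff\<close>)
    then have "(\<integral>\<^sup>+z. ennreal (\<pi> z) \<partial>lborel) = 0" by (subst nn_integral_0_iff_AE) auto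
    then show False using \<pi>1 by simp
  qed
  then show "0 < (\<integral>u. exp (- u\<^sup>2 / 2) * g u \<partial>std_normal_distribution)"
    unfolding D by (simp add: zero_less_mult_iff)
  have "(\<integral>z. (1 - std_normal_cdf (1.96 - z)) * std_normal_density (?x - z) * ?s z \<partial>lborel) = D - N"
    unfolding D_def N_def
    by (subst Bochner_Integration.integral_diff[OF iD iN, symmetric])
       (auto intro!: Bochner_Integration.integral_cong simp: algebra_simps)
  then have "predictive_power \<pi> p = (D - N) / D" by (simp add: predictive_power_def D_def)
  also have "\<dots> = 1 - N / D" using pos by (simp add: diff_divide_distrib)
  also have "N / D = (\<integral>u. exp (- u\<^sup>2 / 2) * std_normal_cdf (1.96 - cv p + sqrt 2 * u) * g u \<partial>std_normal_distribution)
      / (\<integral>u. exp (- u\<^sup>2 / 2) * g u \<partial>std_normal_distribution)"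
    unfolding D N by simp
  finally show "predictive_power \<pi> p = 1 - (\<integral>u. exp (- u\<^sup>2 / 2) * std_normal_cdf (1.96 - cv p + sqrt 2 * u) * g u
          \<partial>std_normal_distribution) / (\<integral>u. exp (- u\<^sup>2 / 2) * g u \<partial>std_normal_distribution)" .
qed

theorem theorem2:
  fixes \<pi> :: "real \<Rightarrow> real"
    and s :: "'t \<Rightarrow> real \<Rightarrow> real"
    and \<Theta> :: "'t set"
    and \<theta>0 :: 't
    and M :: "nat \<Rightarrow> 'w measure"
    and Z :: "nat \<Rightarrow> nat \<Rightarrow> 'w \<Rightarrow> real"
    and art :: "nat \<Rightarrow> nat \<Rightarrow> 'art"
    and L :: nat
    and \<theta>_hat :: "nat \<Rightarrow> 'w \<Rightarrow> 't"
    and A p :: real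
  assumes density: "is_density \<pi>"
    and density_bounded: "bounded (range \<pi>)"
    and \<theta>0: "\<theta>0 \<in> \<Theta>"
    and selection_measurable: "s \<theta>0 \<in> borel_measurable borel"
    and selection_probability: "\<And>t. 0 \<le> s \<theta>0 t \<and> s \<theta>0 t \<le> 1"
    and selection_even: "\<And>\<theta> t. \<theta> \<in> \<Theta> \<Longrightarrow> s \<theta> (- t) = s \<theta> t"
    and selection_inf: "0 < (INF \<theta>\<in>\<Theta>. INF t. ereal (s \<theta> t))"
    and spaces: "\<And>n. prob_space (M n)"
    and sample_measurable: "\<And>n i. i \<in> {1..n} \<Longrightarrow> Z n i \<in> borel_measurable (M n)"
    and sample_law: "\<And>n i. i \<in> {1..n} \<Longrightarrow>
          distr (M n) borel (\<lambda>\<omega>. \<bar>Z n i \<omega>\<bar>) = published_abs_law \<pi> (s \<theta>0)"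
    and sample_indep: "\<And>n. indep_across_articles (M n) n (art n) (Z n)"
    and L: "1 \<le> L"
    and article_size: "\<And>n a. card (article_obs n (art n) a) \<le> L"
    and estimator: "\<And>n \<omega>. \<omega> \<in> space (M n) \<Longrightarrow> \<theta>_hat n \<omega> \<in> \<Theta>"
    and estimator_rate: "bounded_in_prob M
          (\<lambda>n \<omega>. SUP t. real n powr (1 / 3) * \<bar>1 / s (\<theta>_hat n \<omega>) t - 1 / s \<theta>0 t\<bar>)"
    and A: "0 < A"
    and p: "0 < p" "p < 1"
  shows "converges_in_prob M
          (\<lambda>n \<omega>. r_np A p n (s (\<theta>_hat n \<omega>)) (\<lambda>i. Z n i \<omega>))
          (predictive_power \<pi> p)"
proof -
  have [measurable]: "\<pi> \<in> borel_measurable borel" and \<pi>0: "\<And>z. 0 \<le> \<pi> z"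
    and \<pi>1: "(\<integral>\<^sup>+z. ennreal (\<pi> z) \<partial>lborel) = 1"
    using density by (auto simp: is_density_def)
  note [measurable] = selection_measurable
  obtain B where "\<And>z. \<bar>\<pi> z\<bar> \<le> B"
    using density_bounded by (auto simp: bounded_iff)
  then have B: "\<pi> z \<le> B" for z by (meson abs_ge_self order_trans)
  \<comment> \<open>The infimum is taken in the extended reals; any real number strictly between 0
    and it is a uniform lower bound.\<close>
  obtain \<delta> where \<delta>: "0 < \<delta>" "\<And>\<theta> t. \<theta> \<in> \<Theta> \<Longrightarrow> \<delta> \<le> s \<theta> t"
  proof -
    obtain \<delta> where d: "0 < ereal \<delta>" "ereal \<delta> < (INF \<theta>\<in>\<Theta>. INF t. ereal (s \<theta> t))"
      using ereal_dense2[OF selection_inf] by auto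
    have "\<delta> \<le> s \<theta> t" if "\<theta> \<in> \<Theta>" for \<theta> t
    proof -
      have "(INF \<theta>\<in>\<Theta>. INF t. ereal (s \<theta> t)) \<le> (INF t. ereal (s \<theta> t))" by (rule INF_lower[OF that])
      also have "\<dots> \<le> ereal (s \<theta> t)" by (rule INF_lower) simp
      finally have "ereal \<delta> \<le> ereal (s \<theta> t)" using d(2) by (metis less_imp_le order_trans)
      then show ?thesis by simp
    qed
    with d(1) show thesis by (intro that) auto
  qed
  define s0 where "s0 = s \<theta>0"
  have s0_pos: "0 < s0 t" for t using \<delta>(1) \<delta>(2)[OF \<theta>0, of t] by (simp add: s0_def)
  have s0_even: "s0 (- t) = s0 t" for t unfolding s0_def by (rule selection_even[OF \<theta>0])
  have s0_le: "s0 t \<le> 1" for t using selection_probability by (simp add: s0_def)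
  have s0_m [measurable]: "s0 \<in> borel_measurable borel" unfolding s0_def by simp
  define g where "g u = symmetrized \<pi> (cv p - sqrt 2 * u)" for u
  have gm: "g \<in> borel_measurable borel" unfolding g_def[abs_def] symmetrized_def by measurable
  have gB: "\<bar>g u\<bar> \<le> B" for u
    using \<pi>0[of "cv p - sqrt 2 * u"] \<pi>0[of "- (cv p - sqrt 2 * u)"] B[of "cv p - sqrt 2 * u"] B[of "- (cv p - sqrt 2 * u)"]
    by (simp add: g_def symmetrized_def)
  let ?P = "published_abs_law \<pi> s0"
  let ?K = "\<lambda>j t. hermite_kernel (cv p) j t / s0 t"
  obtain c C where c: "0 < c"
    and m1: "\<And>j. integrable ?P (?K j)"
    and m2: "\<And>j. (\<integral>t. ?K j t \<partial>?P) = 2 / c * (2 powr (- real j / 2) * hermite_coeff g j)"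
    and m3: "\<And>j. integrable ?P (\<lambda>t. (?K j t)\<^sup>2)"
    and m4: "\<And>j. (\<integral>t. (?K j t)\<^sup>2 \<partial>?P) \<le> C"
    unfolding g_def
    by (rule published_abs_law_moments[of \<pi> s0 B \<delta> "cv p"])
       (use \<pi>0 \<pi>1 B \<delta> \<theta>0 s0_le s0_even in \<open>auto simp: s0_def\<close>)
  have s0_abs [simp]: "s0 \<bar>t\<bar> = s0 t" for t using s0_even by (simp add: abs_if)
  \<comment> \<open>Only the law of the absolute value is given, so moments can be transferred for
    even integrands only.\<close>
  have transfer: "integrable (M n) (\<lambda>\<omega>. F (Z n i \<omega>)) \<longleftrightarrow> integrable ?P F"
      "(\<integral>\<omega>. F (Z n i \<omega>) \<partial>M n) = (\<integral>t. F t \<partial>?P)"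
    if i: "i \<in> {1..n}" and F: "F \<in> borel_measurable borel" "\<And>t. F \<bar>t\<bar> = F t"
    for n i and F :: "real \<Rightarrow> real"
  proof -
    have P: "?P = distr (M n) borel (\<lambda>\<omega>. \<bar>Z n i \<omega>\<bar>)" using sample_law[OF i] by (simp add: s0_def)
    have Zm: "(\<lambda>\<omega>. \<bar>Z n i \<omega>\<bar>) \<in> borel_measurable (M n)"
      using sample_measurable[OF i] by (rule borel_measurable_abs)
    show "integrable (M n) (\<lambda>\<omega>. F (Z n i \<omega>)) \<longleftrightarrow> integrable ?P F"
      unfolding P integrable_distr_eq[OF Zm F(1)] F(2) ..
    show "(\<integral>\<omega>. F (Z n i \<omega>) \<partial>M n) = (\<integral>t. F t \<partial>?P)"
      unfolding P integral_distr[OF Zm F(1)] F(2) ..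
  qed
  define X where "X n \<omega> = (SUP t. real n powr (1 / 3) * \<bar>1 / s (\<theta>_hat n \<omega>) t - 1 / s0 t\<bar>)" for n \<omega>
  have X: "bounded_in_prob M X" using estimator_rate unfolding X_def[abs_def] s0_def .
  have s_hat: "\<bar>1 / s (\<theta>_hat n \<omega>) t - 1 / s0 t\<bar> \<le> \<bar>X n \<omega>\<bar> / real n powr (1 / 3)"
    if n: "1 \<le> n" and \<omega>: "\<omega> \<in> space (M n)" for n \<omega> t
  proof -
    \<comment> \<open>A real supremum bounds its terms only if the set is bounded above. Here both
      reciprocals lie between 0 and \<open>1 / \<delta>\<close>, which supplies that bound.\<close>
    have inv: "0 \<le> 1 / s \<theta> t \<and> 1 / s \<theta> t \<le> 1 / \<delta>" if "\<theta> \<in> \<Theta>" for \<theta> t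
      using \<delta>(1) \<delta>(2)[OF that, of t] by (auto intro!: divide_left_mono mult_pos_pos)
    have "\<bar>1 / s (\<theta>_hat n \<omega>) t - 1 / s0 t\<bar> \<le> 1 / \<delta>" for t
      using inv[OF estimator[OF \<omega>], of t] inv[OF \<theta>0, of t] unfolding s0_def by linarith
    then have "bdd_above (range (\<lambda>t. real n powr (1 / 3) * \<bar>1 / s (\<theta>_hat n \<omega>) t - 1 / s0 t\<bar>))"
      by (intro bdd_aboveI[of _ "real n powr (1 / 3) * (1 / \<delta>)"]) (auto intro!: mult_left_mono simp del: times_divide_eq_right mult_1_right)
    then have "real n powr (1 / 3) * \<bar>1 / s (\<theta>_hat n \<omega>) t - 1 / s0 t\<bar> \<le> X n \<omega>"
      unfolding X_def by (rule cSUP_upper[OF UNIV_I])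
    also have "\<dots> \<le> \<bar>X n \<omega>\<bar>" by simp
    finally show ?thesis using n by (simp add: pos_le_divide_eq mult.commute)
  qed
  \<comment> \<open>The constant \<open>c\<close> is fixed before \<open>h\<close>, so the limits
    for \<open>h1\<close> and \<open>h0\<close> carry the same factor \<open>2 / c\<close>.\<close>
  have estimator_converges: "converges_in_prob M
      (\<lambda>n \<omega>. \<Sum>j=0..trunc_J A n. hermite_coeff h j * coeff_b_hat p n (s (\<theta>_hat n \<omega>)) (\<lambda>i. Z n i \<omega>) j)
      (2 / c * (\<integral>u. h u * g u \<partial>std_normal_distribution))"
    if h: "continuous_on UNIV h" "\<And>u. \<bar>h u\<bar> \<le> 1" for h
  proof (rule series_estimator_converges[where art = art and L = L and s = s0 and C = C and X = X and A = A])
    fix n i j :: nat assume i: "i \<in> {1..n}"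
    show "integrable (M n) (\<lambda>\<omega>. ?K j (Z n i \<omega>))"
      by (subst transfer(1)[OF i]) (use m1 in auto)
    show "(\<integral>\<omega>. ?K j (Z n i \<omega>) \<partial>M n) = 2 / c * (2 powr (- real j / 2) * hermite_coeff g j)"
      by (subst transfer(2)[OF i]) (use m2 in auto)
    show "integrable (M n) (\<lambda>\<omega>. (?K j (Z n i \<omega>))\<^sup>2)"
      by (subst transfer(1)[OF i]) (use m3 in auto)
    show "(\<integral>\<omega>. (?K j (Z n i \<omega>))\<^sup>2 \<partial>M n) \<le> C"
      by (subst transfer(2)[OF i]) (use m4 in auto)
  qed (fact spaces sample_measurable sample_indep article_size s0_m s0_pos s0_le X s_hat A h gm gB)+
  define h1 where "h1 u = exp (- u\<^sup>2 / 2) * std_normal_cdf (1.96 - cv p + sqrt 2 * u)" for u :: real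
  define h0 where "h0 u = exp (- u\<^sup>2 / 2)" for u :: real
  define I1 where "I1 = (\<integral>u. h1 u * g u \<partial>std_normal_distribution)"
  define I0 where "I0 = (\<integral>u. h0 u * g u \<partial>std_normal_distribution)"
  have h0_c: "continuous_on UNIV h0" unfolding h0_def by (intro continuous_intros) auto
  have h1_c: "continuous_on UNIV h1" unfolding h1_def by (intro continuous_intros) auto
  have h0_le: "\<bar>h0 u\<bar> \<le> 1" for u by (simp add: h0_def)
  have h1_le: "\<bar>h1 u\<bar> \<le> 1" for u
    using mult_mono[of "exp (- u\<^sup>2 / 2)" 1 "std_normal_cdf (1.96 - cv p + sqrt 2 * u)" 1] std_normal_cdf_bounds
    by (simp add: h1_def abs_mult)
  have I0: "0 < I0" and pp: "predictive_power \<pi> p = 1 - I1 / I0"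
    using predictive_power_eq[OF _ \<pi>0 B \<pi>1, of p] by (simp_all add: I0_def I1_def h0_def h1_def g_def)
  \<comment> \<open>Continuity at the limit requires \<open>I0\<close> and \<open>c\<close> to be
    nonzero; the common factor \<open>2 / c\<close> then drops out of the quotient.\<close>
  have "isCont (\<lambda>(x, y). 1 - x / y) (2 / c * I1, 2 / c * I0)"
    unfolding split_beta' using I0 c by (intro continuous_intros) auto
  from converges_in_prob_continuous2[OF estimator_converges[OF h1_c h1_le, folded I1_def]
      estimator_converges[OF h0_c h0_le, folded I0_def] this]
  have "converges_in_prob M (\<lambda>n \<omega>. r_np A p n (s (\<theta>_hat n \<omega>)) (\<lambda>i. Z n i \<omega>)) (1 - (2 / c * I1) / (2 / c * I0))"
    unfolding r_np_def coeff_a_eq coeff_d_eq h0_def[abs_def] h1_def[abs_def] .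
  moreover have "(2 / c * I1) / (2 / c * I0) = I1 / I0" using c by simp
  ultimately show ?thesis unfolding pp by (simp only:)
qed

end
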